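(* For a metric skeletoid $\mathcal F$ the following conditions are equivalent: (i) $\mathcal F$ is the skeleton of a Heine-Borel absolutely homogeneous metric space; (ii) $\mathcal F$ is layer-closed and for any integer $N>1$ there exists a positive integer $\mu_N$ such that each metric space belonging to $\mathcal F$ all of whose positive distances lie in $[1/N,N]$ has size not greater than $\mu_N$. Moreover, $\mathcal F$ is compact (that is, $\mathcal F$ is the skeleton of a compact absolutely homogeneous metric space) if and only if (ii) holds and all metric spaces from $\mathcal F$ have uniformly bounded diameters.
   Context: A metric space is absolutely homogeneous (AB-HO) if every isometric map from a subset of it into it extends to an isometry of the space onto itself. It is Heine-Borel if all its closed balls are compact. The skeleton of an AB-HO metric space $X$ is the class of all finite non-empty metric spaces isometric to a subspace of $X$. A metric skeletoid is a skeletoid consisting of metric spaces. Explicitly, it is a class $\mathcal F$ of finite non-empty metric spaces, closed under taking non-empty subspaces and under isometric copies, such that: (MBP) for each $c>0$ attained as a distance in some member of $\mathcal F$ there is a positive integer $\mu(c)$ such that each member of $\mathcal F$ in which any two distinct points are at distance $c$ has at most $\mu(c)$ points; (AP) whenever $V$ is a finite set, $a\neq b$ are points of $V$, and $d$ is a function on $(V\times V)\setminus\{(a,b),(b,a)\}$ such that $(V\setminus\{a\},d)$ and $(V\setminus\{b\},d)$ are metric spaces belonging to $\mathcal F$, with $d(a,c)=d(c,a)$, $d(b,c)=d(c,b)$, and $d(a,c)\neq d(b,c)$ for some $c\in V\setminus\{a,b\}$, then $d$ extends to a metric on $V$ such that $(V,d)\in\mathcal F$. With $I_n=\{1,\ldots,n\}$,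 $\mathcal F$ is layer-closed if for any $n>1$ the set of all metrics $d$ on $I_n$ with $(I_n,d)\in\mathcal F$ is closed (in the pointwise convergence topology) in the set of all metrics on $I_n$. *)

theory Defs
  imports "HOL-Analysis.Analysis"
begin

text \<open>
  Metric spaces are elements of the library type \<open>'a metric\<close> (a carrier and a distance; the
  values of the distance off the carrier are junk and are never inspected below). The empty
  space is a metric space.
\<close>

definition isometric_map :: "'a metric \<Rightarrow> 'b metric \<Rightarrow> 'a set \<Rightarrow> ('a \<Rightarrow> 'b) \<Rightarrow> bool" where
  "isometric_map m m' S f \<longleftrightarrow>
     f \<in> S \<rightarrow> mspace m' \<and> (\<forall>x\<in>S. \<forall>y\<in>S. mdist m' (f x) (f y) = mdist m x y)"

definition isometry_onto :: "'a metric \<Rightarrow> 'b metric \<Rightarrow> ('a \<Rightarrow> 'b) \<Rightarrow> bool" where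
  "isometry_onto m m' f \<longleftrightarrow> isometric_map m m' (mspace m) f \<and> f ` mspace m = mspace m'"

definition isometric :: "'a metric \<Rightarrow> 'b metric \<Rightarrow> bool" where
  "isometric m m' \<longleftrightarrow> (\<exists>f. isometry_onto m m' f)"

definition absolutely_homogeneous :: "'a metric \<Rightarrow> bool" where
  "absolutely_homogeneous m \<longleftrightarrow>
     (\<forall>S f. S \<subseteq> mspace m \<and> isometric_map m m S f \<longrightarrow>
        (\<exists>g. isometry_onto m m g \<and> (\<forall>x\<in>S. g x = f x)))"

definition Heine_Borel :: "'a metric \<Rightarrow> bool" where
  "Heine_Borel m \<longleftrightarrow> (\<forall>x\<in>mspace m. \<forall>r. compactin (mtopology_of m) (mcball_of m x r))"

definition compact_metric :: "'a metric \<Rightarrow> bool" where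
  "compact_metric m \<longleftrightarrow> compact_space (mtopology_of m)"

text \<open>
  Every finite metric space is isometric to one with carrier a set of natural numbers, so a
  class of finite metric spaces that is closed under isometric copies is represented by its
  members of type \<open>nat metric\<close>. Closure under isometric copies also makes membership
  independent of the junk values of the distance.
\<close>

definition skeleton :: "'a metric \<Rightarrow> nat metric set" where
  "skeleton X = {m. finite (mspace m) \<and> mspace m \<noteq> {} \<and>
                    (\<exists>S\<subseteq>mspace X. isometric m (submetric X S))}"

text \<open>
  \<open>space_in F V d\<close> says that \<open>(V, d)\<close> is a metric space belonging to \<open>F\<close>; only the values of
  \<open>d\<close> on \<open>V \<times> V\<close> matter. With \<open>F = UNIV\<close> it says that \<open>d\<close> is a metric on \<open>V\<close>.
\<close>

definition space_in :: "nat metric set \<Rightarrow> nat set \<Rightarrow> (nat \<Rightarrow> nat \<Rightarrow> real) \<Rightarrow> bool" where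
  "space_in F V d \<longleftrightarrow> (\<exists>m\<in>F. mspace m = V \<and> (\<forall>x\<in>V. \<forall>y\<in>V. mdist m x y = d x y))"

definition mono_bounded_property :: "nat metric set \<Rightarrow> bool" where
  "mono_bounded_property F \<longleftrightarrow>
     (\<forall>c>0. (\<exists>m\<in>F. \<exists>x\<in>mspace m. \<exists>y\<in>mspace m. mdist m x y = c) \<longrightarrow>
        (\<exists>\<mu>::nat. \<mu> > 0 \<and>
           (\<forall>m\<in>F. (\<forall>x\<in>mspace m. \<forall>y\<in>mspace m. x \<noteq> y \<longrightarrow> mdist m x y = c) \<longrightarrow>
                  card (mspace m) \<le> \<mu>)))"

text \<open>
  The partial distance function is a total \<open>d\<close> whose values at \<open>(a, b)\<close> and \<open>(b, a)\<close> are never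
  used; \<open>d'\<close> is its extension.
\<close>

definition amalgamation_property :: "nat metric set \<Rightarrow> bool" where
  "amalgamation_property F \<longleftrightarrow>
     (\<forall>V a b d. finite V \<and> a \<in> V \<and> b \<in> V \<and> a \<noteq> b \<and>
        space_in F (V - {a}) d \<and> space_in F (V - {b}) d \<and>
        (\<forall>c\<in>V - {a, b}. d a c = d c a \<and> d b c = d c b) \<and>
        (\<exists>c\<in>V - {a, b}. d a c \<noteq> d b c) \<longrightarrow>
        (\<exists>d'. (\<forall>(x, y)\<in>V \<times> V - {(a, b), (b, a)}. d' x y = d x y) \<and> space_in F V d'))"

definition metric_skeletoid :: "nat metric set \<Rightarrow> bool" where
  "metric_skeletoid F \<longleftrightarrow>
     (\<forall>m\<in>F. finite (mspace m) \<and> mspace m \<noteq> {}) \<and>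
     (\<forall>m\<in>F. \<forall>S. S \<subseteq> mspace m \<and> S \<noteq> {} \<longrightarrow> submetric m S \<in> F) \<and>
     (\<forall>m\<in>F. \<forall>m'. isometric m m' \<longrightarrow> m' \<in> F) \<and>
     mono_bounded_property F \<and> amalgamation_property F"

text \<open>
  The metrics \<open>d\<close> on \<open>V\<close> with \<open>(V, d)\<close> in \<open>F\<close>, as functions on \<open>V \<times> V\<close> (extensional, hence
  points of the product space, whose topology is that of pointwise convergence).
\<close>

definition metrics_in :: "nat metric set \<Rightarrow> nat set \<Rightarrow> (nat \<times> nat \<Rightarrow> real) set" where
  "metrics_in F V = {d \<in> extensional (V \<times> V). space_in F V (curry d)}"

definition layer_closed :: "nat metric set \<Rightarrow> bool" where
  "layer_closed F \<longleftrightarrow>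
     (\<forall>n>1. closedin
        (subtopology (product_topology (\<lambda>_. euclideanreal) ({1..n} \<times> {1..n}))
                     (metrics_in UNIV {1..n}))
        (metrics_in F {1..n}))"

definition size_bounded :: "nat metric set \<Rightarrow> bool" where
  "size_bounded F \<longleftrightarrow>
     (\<forall>N::nat. N > 1 \<longrightarrow> (\<exists>\<mu>::nat. \<mu> > 0 \<and>
        (\<forall>m\<in>F. (\<forall>x\<in>mspace m. \<forall>y\<in>mspace m. mdist m x y > 0 \<longrightarrow>
                  mdist m x y \<in> {1 / real N..real N}) \<longrightarrow>
               card (mspace m) \<le> \<mu>)))"

text \<open>Used for nonempty finite spaces only, where the supremum is a maximum.\<close>

definition mdiameter :: "'a metric \<Rightarrow> real" where
  "mdiameter m = (SUP (x, y)\<in>mspace m \<times> mspace m. mdist m x y)"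

end

theory Submission
  imports Defs
begin

text \<open>
  Necessity is a compactness argument. In an absolutely homogeneous space every finite subspace
  has a copy through a prescribed base point \<open>p\<close> (\<open>absolutely_homogeneous_copy_at\<close>). Copies of
  members that converge pointwise to a finite metric therefore all lie in one compact ball, and
  the limit of a common convergent subsequence of their points realizes the limit metric: the
  skeleton is layer-closed. A member with distances in \<open>[1/N, N]\<close> becomes a \<open>1/N\<close>-separated subset
  of the compact ball of radius \<open>N\<close> about \<open>p\<close>, so its size is bounded.

  Sufficiency asks for a space; let \<open>F\<close> be nonempty, since the empty class is the skeleton of the
  empty space. Call a metric space an \<open>F\<close>-space if its finite subspaces embed in
  members of \<open>F\<close> (\<open>age_in\<close>). The distances from a hypothetical further point form a function \<open>h\<close> on the
  space, a \<^emph>\<open>point type\<close>, if over each finite subset they can be realized in a member of \<open>F\<close>. A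
  space is \<^emph>\<open>saturated\<close> if it is an \<open>F\<close>-space in which every point type over the whole space is
  realized. An \<open>F\<close>-space that is maximal under inclusion is saturated: a type that vanishes somewhere
  is the type of an existing point, and any other type would allow a new point to be added. Maximal
  \<open>F\<close>-spaces come from Zorn's lemma, inside a universe with room for every \<open>F\<close>-space plus one point.
  That such a universe exists is a consequence of the size bounds: bounded sets of an \<open>F\<close>-space are totally bounded, so
  \<open>F\<close>-spaces are separable and have at most continuum many points (\<open>age_in_lepoll\<close>).

  In a saturated space a point type \<open>h\<close> over any nonempty subset is realized
  (\<open>realize_point_type\<close>), because it extends to a type over the whole space. To extend \<open>h\<close> to one more
  point, each finite part of the domain leaves a nonempty compact set of admissible
  values: nonempty by amalgamation (\<open>amalgamate_point_types\<close>), closed because pointwise limits of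
  finite pseudometric spaces over \<open>F\<close> stay over \<open>F\<close> (\<open>embeddable_limit\<close>, which is layer-closedness
  freed from the requirement that limits separate points). These sets have the finite intersection
  property, so one value serves all finite parts; Zorn's lemma does the rest.

  Everything follows from the realization of types. A partial isometry transports the type of a point
  outside its domain to its range, so maximal partial isometries are total and onto: the space is
  absolutely homogeneous. Members of \<open>F\<close> are embedded point by point, so the skeleton is \<open>F\<close>. The
  limit of the distances from a Cauchy sequence is a point type, and the point that realizes it is
  the limit of the sequence; completeness and total boundedness of balls give compact balls. If the
  diameters are bounded, a single ball is the whole space.
\<close>

section \<open>Finite pseudometric spaces over a class\<close>

text \<open>
  \<open>d\<close> may vanish off the diagonal. Pseudometrics make the notion stable under pullback along
  arbitrary maps and, if \<open>F\<close> is layer-closed, under pointwise limits.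
\<close>
definition embeddable :: "nat metric set \<Rightarrow> 'b set \<Rightarrow> ('b \<Rightarrow> 'b \<Rightarrow> real) \<Rightarrow> bool" where
  "embeddable F A d \<longleftrightarrow>
     (\<exists>m\<in>F. \<exists>f. f \<in> A \<rightarrow> mspace m \<and> (\<forall>x\<in>A. \<forall>y\<in>A. mdist m (f x) (f y) = d x y))"

text \<open>
  The point \<open>p\<close> with distances \<open>h\<close> to \<open>A\<close> may coincide with the image of a point of \<open>A\<close>; so the types
  of points of a space and the types of genuine one-point extensions are treated alike.
\<close>
definition point_type ::
    "nat metric set \<Rightarrow> 'b set \<Rightarrow> ('b \<Rightarrow> 'b \<Rightarrow> real) \<Rightarrow> ('b \<Rightarrow> real) \<Rightarrow> bool" where
  "point_type F A d h \<longleftrightarrow>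
     (\<exists>m\<in>F. \<exists>f p. f \<in> A \<rightarrow> mspace m \<and> (\<forall>x\<in>A. \<forall>y\<in>A. mdist m (f x) (f y) = d x y) \<and>
                p \<in> mspace m \<and> (\<forall>x\<in>A. mdist m p (f x) = h x))"

text \<open>
  The distance on \<open>A\<close> with one point adjoined, which turns point types into embeddable spaces.
\<close>
definition adjoin :: "('b \<Rightarrow> 'b \<Rightarrow> real) \<Rightarrow> ('b \<Rightarrow> real) \<Rightarrow> 'b option \<Rightarrow> 'b option \<Rightarrow> real" where
  "adjoin d h u v = (case u of
      None \<Rightarrow> (case v of None \<Rightarrow> 0 | Some y \<Rightarrow> h y)
    | Some x \<Rightarrow> (case v of None \<Rightarrow> h x | Some y \<Rightarrow> d x y))"

lemma embeddableI:
  assumes "m \<in> F" "f \<in> A \<rightarrow> mspace m"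
    and "\<And>x y. x \<in> A \<Longrightarrow> y \<in> A \<Longrightarrow> mdist m (f x) (f y) = d x y"
  shows "embeddable F A d"
  using assms unfolding embeddable_def by blast

lemma point_typeI:
  assumes "m \<in> F" "f \<in> A \<rightarrow> mspace m" "p \<in> mspace m"
    and "\<And>x y. x \<in> A \<Longrightarrow> y \<in> A \<Longrightarrow> mdist m (f x) (f y) = d x y"
    and "\<And>x. x \<in> A \<Longrightarrow> mdist m p (f x) = h x"
  shows "point_type F A d h"
  using assms unfolding point_type_def by blast

lemma point_typeE:
  assumes "point_type F A d h"
  obtains m f p where "m \<in> F" "f \<in> A \<rightarrow> mspace m" "p \<in> mspace m"
    and "\<And>x y. x \<in> A \<Longrightarrow> y \<in> A \<Longrightarrow> mdist m (f x) (f y) = d x y"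
    and "\<And>x. x \<in> A \<Longrightarrow> mdist m p (f x) = h x"
  using assms unfolding point_type_def by blast

lemma embeddable_pullback:
  assumes "embeddable F A d" "g \<in> B \<rightarrow> A"
    and "\<And>x y. x \<in> B \<Longrightarrow> y \<in> B \<Longrightarrow> d' x y = d (g x) (g y)"
  shows "embeddable F B d'"
proof -
  obtain m f where "m \<in> F" "f \<in> A \<rightarrow> mspace m" "\<forall>x\<in>A. \<forall>y\<in>A. mdist m (f x) (f y) = d x y"
    using assms(1) unfolding embeddable_def by blast
  then show ?thesis
    using assms(2,3) by (intro embeddableI[where m=m and f="f \<circ> g"]) (auto simp: Pi_iff)
qed

lemma point_type_pullback:
  assumes "point_type F A d h" "g \<in> B \<rightarrow> A"
    and "\<And>x y. x \<in> B \<Longrightarrow> y \<in> B \<Longrightarrow> d' x y = d (g x) (g y)"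
    and "\<And>x. x \<in> B \<Longrightarrow> h' x = h (g x)"
  shows "point_type F B d' h'"
proof -
  obtain m f p where "m \<in> F" "f \<in> A \<rightarrow> mspace m" "p \<in> mspace m"
    "\<And>x y. x \<in> A \<Longrightarrow> y \<in> A \<Longrightarrow> mdist m (f x) (f y) = d x y"
    "\<And>x. x \<in> A \<Longrightarrow> mdist m p (f x) = h x"
    using assms(1) by (elim point_typeE) (rule that)
  then show ?thesis
    using assms(2-) by (intro point_typeI[where m=m and f="f \<circ> g" and p=p]) (auto simp: Pi_iff)
qed

lemma point_type_subset:
  "point_type F A d h \<Longrightarrow> B \<subseteq> A \<Longrightarrow> point_type F B d h"
  by (rule point_type_pullback[where g="\<lambda>x. x"]) auto

lemma point_type_iff_embeddable:
  "point_type F A d h \<longleftrightarrow> embeddable F (insert None (Some ` A)) (adjoin d h)"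
proof
  assume "point_type F A d h"
  then obtain m f p where m: "m \<in> F" "f \<in> A \<rightarrow> mspace m" "p \<in> mspace m"
    "\<And>x y. x \<in> A \<Longrightarrow> y \<in> A \<Longrightarrow> mdist m (f x) (f y) = d x y"
    "\<And>x. x \<in> A \<Longrightarrow> mdist m p (f x) = h x"
    by (elim point_typeE) (rule that)
  have "d x y = d y x" if "x \<in> A" "y \<in> A" for x y
    using m(4)[of x y] m(4)[of y x] that by (simp add: mdist_commute)
  then show "embeddable F (insert None (Some ` A)) (adjoin d h)"
    using m by (intro embeddableI[where m=m and f="case_option p f"])
      (auto simp: adjoin_def Pi_iff mdist_commute split: option.splits)
next
  assume "embeddable F (insert None (Some ` A)) (adjoin d h)"
  then obtain m f where m: "m \<in> F" "f \<in> insert None (Some ` A) \<rightarrow> mspace m"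
     and e: "\<And>u v. u \<in> insert None (Some ` A) \<Longrightarrow> v \<in> insert None (Some ` A) \<Longrightarrow> mdist m (f u) (f v) = adjoin d h u v"
    unfolding embeddable_def by blast
  show "point_type F A d h"
  proof (rule point_typeI[where m=m and f="f \<circ> Some" and p="f None"])
    show "f \<circ> Some \<in> A \<rightarrow> mspace m" "f None \<in> mspace m" using m(2) by auto
    show "mdist m ((f \<circ> Some) x) ((f \<circ> Some) y) = d x y" if "x \<in> A" "y \<in> A" for x y
      using e[of "Some x" "Some y"] that by (simp add: adjoin_def)
    show "mdist m (f None) ((f \<circ> Some) x) = h x" if "x \<in> A" for x
      using e[of None "Some x"] that by (simp add: adjoin_def)
  qed (rule m(1))
qed

lemma embeddable_pseudometric:
  assumes "embeddable F A d"
  shows "x \<in> A \<Longrightarrow> d x x = 0"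
    and "x \<in> A \<Longrightarrow> y \<in> A \<Longrightarrow> 0 \<le> d x y"
    and "x \<in> A \<Longrightarrow> y \<in> A \<Longrightarrow> d x y = d y x"
    and "x \<in> A \<Longrightarrow> y \<in> A \<Longrightarrow> z \<in> A \<Longrightarrow> d x z \<le> d x y + d y z"
proof -
  obtain m f where "m \<in> F" and f: "f \<in> A \<rightarrow> mspace m" and "\<forall>x\<in>A. \<forall>y\<in>A. mdist m (f x) (f y) = d x y"
    using assms unfolding embeddable_def by blast
  from this(3) have d: "d x y = mdist m (f x) (f y)" if "x \<in> A" "y \<in> A" for x y
    using that by simp
  have fm: "f x \<in> mspace m" if "x \<in> A" for x
    using f that by auto
  show "x \<in> A \<Longrightarrow> d x x = 0" "x \<in> A \<Longrightarrow> y \<in> A \<Longrightarrow> 0 \<le> d x y"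
    using d fm by auto
  show "x \<in> A \<Longrightarrow> y \<in> A \<Longrightarrow> d x y = d y x"
    using d mdist_commute by metis
  show "x \<in> A \<Longrightarrow> y \<in> A \<Longrightarrow> z \<in> A \<Longrightarrow> d x z \<le> d x y + d y z"
    using d fm mdist_triangle[of "f x" m "f y" "f z"] by auto
qed

lemma skeletoid_closed:
  assumes "metric_skeletoid F"
  shows "m \<in> F \<Longrightarrow> finite (mspace m)" "m \<in> F \<Longrightarrow> mspace m \<noteq> {}"
    and "m \<in> F \<Longrightarrow> S \<subseteq> mspace m \<Longrightarrow> S \<noteq> {} \<Longrightarrow> submetric m S \<in> F"
    and "m \<in> F \<Longrightarrow> isometric m m' \<Longrightarrow> m' \<in> F"
  using assms unfolding metric_skeletoid_def by blast+

text \<open>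
  Closure under subspaces and isometric copies in one step: any relabelling by naturals of some
  points of a member is again a member.
\<close>
lemma space_inI:
  assumes sk: "metric_skeletoid F" and m: "m \<in> F"
    and W: "W \<noteq> {}" "\<phi> \<in> W \<rightarrow> mspace m" "inj_on \<phi> W"
    and d: "\<And>i j. i \<in> W \<Longrightarrow> j \<in> W \<Longrightarrow> d i j = mdist m (\<phi> i) (\<phi> j)"
  shows "space_in F W d"
proof -
  have ms: "Metric_space W (\<lambda>i j. mdist m (\<phi> i) (\<phi> j))"
  proof
    show "mdist m (\<phi> i) (\<phi> j) = mdist m (\<phi> j) (\<phi> i)" for i j by (rule mdist_commute)
    show "mdist m (\<phi> i) (\<phi> j) = 0 \<longleftrightarrow> i = j" if "i \<in> W" "j \<in> W" for i j
      using mdist_zero[of "\<phi> i" m "\<phi> j"] funcset_mem[OF W(2)] inj_on_eq_iff[OF W(3)] that by simp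
    show "mdist m (\<phi> i) (\<phi> k) \<le> mdist m (\<phi> i) (\<phi> j) + mdist m (\<phi> j) (\<phi> k)"
      if "i \<in> W" "j \<in> W" "k \<in> W" for i j k
      using W(2) that by (intro mdist_triangle) auto
  qed simp
  define m' where "m' = metric (W, \<lambda>i j. mdist m (\<phi> i) (\<phi> j))"
  have m': "mspace m' = W" "\<And>i j. mdist m' i j = mdist m (\<phi> i) (\<phi> j)"
    unfolding m'_def using Metric_space.mspace_metric[OF ms] Metric_space.mdist_metric[OF ms] by auto
  have sub: "\<phi> ` W \<subseteq> mspace m" "\<phi> ` W \<noteq> {}"
    using W by auto
  have "isometric (submetric m (\<phi> ` W)) m'"
    unfolding isometric_def isometry_onto_def isometric_map_def
    using sub by (intro exI[of _ "inv_into W \<phi>"])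
      (auto simp: m' W(3) Int_absorb2 image_image)
  then have "m' \<in> F"
    using skeletoid_closed(3)[OF sk m sub] skeletoid_closed(4)[OF sk] by blast
  then show ?thesis
    unfolding space_in_def using m' d by auto
qed

lemma space_in_imp_embeddable: "space_in F W d \<Longrightarrow> embeddable F W d"
  unfolding space_in_def by (auto intro!: embeddableI[where f="\<lambda>x. x"])

lemma space_in_UNIV_I:
  assumes "\<And>i j. i \<in> W \<Longrightarrow> j \<in> W \<Longrightarrow> 0 \<le> d i j"
    and "\<And>i j. i \<in> W \<Longrightarrow> j \<in> W \<Longrightarrow> d i j = d j i"
    and "\<And>i j. i \<in> W \<Longrightarrow> j \<in> W \<Longrightarrow> d i j = 0 \<longleftrightarrow> i = j"
    and "\<And>i j k. i \<in> W \<Longrightarrow> j \<in> W \<Longrightarrow> k \<in> W \<Longrightarrow> d i k \<le> d i j + d j k"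
  shows "space_in UNIV W d"
proof -
  let ?d = "\<lambda>i j. if i \<in> W \<and> j \<in> W then d i j else 0"
  have ms: "Metric_space W ?d"
    using assms by unfold_locales auto
  show ?thesis
    unfolding space_in_def
    using Metric_space.mspace_metric[OF ms] Metric_space.mdist_metric[OF ms]
    by (intro bexI[of _ "metric (W, ?d)"]) auto
qed

section \<open>Pointwise limits\<close>

text \<open>
  Basic open sets of a product over a finite index set contain uniform neighbourhoods, so
  closedness can be tested by uniform approximation.
\<close>
lemma closedin_pointwise_iff:
  fixes M S :: "('i \<Rightarrow> real) set"
  assumes "finite K" "M \<subseteq> extensional K" "S \<subseteq> M"
  shows "closedin (subtopology (product_topology (\<lambda>_. euclideanreal) K) M) S \<longleftrightarrow>
    (\<forall>\<delta>\<in>M. (\<forall>\<epsilon>>0. \<exists>\<delta>'\<in>S. \<forall>i\<in>K. \<bar>\<delta>' i - \<delta> i\<bar> < \<epsilon>) \<longrightarrow> \<delta> \<in> S)"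
    (is "closedin ?T S \<longleftrightarrow> ?R")
proof -
  have top: "topspace ?T = M"
    using assms(2) by (auto simp: PiE_def)
  have "closedin ?T S \<longleftrightarrow> openin ?T (M - S)"
    unfolding closedin_def top using assms(3) by auto
  also have "\<dots> \<longleftrightarrow> ?R"
  proof
    assume "openin ?T (M - S)"
    then obtain U where U: "openin (product_topology (\<lambda>_. euclideanreal) K) U" "M - S = U \<inter> M"
      unfolding openin_subtopology by blast
    show ?R
    proof (intro ballI impI, rule ccontr)
      fix \<delta> assume \<delta>: "\<delta> \<in> M" "\<delta> \<notin> S" and ap: "\<forall>\<epsilon>>0. \<exists>\<delta>'\<in>S. \<forall>i\<in>K. \<bar>\<delta>' i - \<delta> i\<bar> < \<epsilon>"
      then have "\<delta> \<in> U" using U by auto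
      then have "\<exists>V. finite {i \<in> K. V i \<noteq> UNIV} \<and> (\<forall>i\<in>K. open (V i)) \<and> \<delta> \<in> Pi\<^sub>E K V \<and> Pi\<^sub>E K V \<subseteq> U"
        using U(1) by (simp add: openin_product_topology_alt)
      then obtain V where V: "\<forall>i\<in>K. open (V i)" "\<delta> \<in> Pi\<^sub>E K V" "Pi\<^sub>E K V \<subseteq> U"
        by blast
      have "\<forall>i\<in>K. \<exists>e>0. \<forall>t. \<bar>t - \<delta> i\<bar> < e \<longrightarrow> t \<in> V i"
        using V unfolding open_dist dist_real_def by (auto simp: PiE_iff)
      then obtain e where e: "\<And>i. i \<in> K \<Longrightarrow> e i > 0" "\<And>i t. i \<in> K \<Longrightarrow> \<bar>t - \<delta> i\<bar> < e i \<Longrightarrow> t \<in> V i"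
        by metis
      define \<epsilon> where "\<epsilon> = Min (insert 1 (e ` K))"
      have "\<epsilon> > 0" "\<And>i. i \<in> K \<Longrightarrow> \<epsilon> \<le> e i"
        using assms(1) e(1) by (auto simp: \<epsilon>_def)
      with ap obtain \<delta>' where "\<delta>' \<in> S" "\<And>i. i \<in> K \<Longrightarrow> \<bar>\<delta>' i - \<delta> i\<bar> < \<epsilon>" by blast
      then have "\<delta>' \<in> Pi\<^sub>E K V" "\<delta>' \<in> S"
        using assms(2,3) e(2) \<open>\<And>i. i \<in> K \<Longrightarrow> \<epsilon> \<le> e i\<close> by (force simp: PiE_def)+
      then show False using V U assms(3) by auto
    qed
  next
    assume R: ?R
    show "openin ?T (M - S)"
    proof (subst openin_subopen, intro ballI)
      fix \<delta> assume \<delta>: "\<delta> \<in> M - S"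
      then obtain \<epsilon> where \<epsilon>: "\<epsilon> > 0" "\<And>\<delta>'. \<delta>' \<in> S \<Longrightarrow> \<exists>i\<in>K. \<not> \<bar>\<delta>' i - \<delta> i\<bar> < \<epsilon>"
        using R by blast
      let ?B = "Pi\<^sub>E K (\<lambda>i. ball (\<delta> i) \<epsilon>)"
      have "openin (product_topology (\<lambda>_. euclideanreal) K) ?B"
        using assms(1) by (simp add: openin_PiE_gen flip: open_openin)
      then have "openin ?T (?B \<inter> M)"
        unfolding openin_subtopology by blast
      moreover have "\<delta> \<in> ?B \<inter> M"
        using \<delta> \<epsilon>(1) assms(2) by (auto simp: PiE_iff)
      moreover have "?B \<inter> M \<subseteq> M - S"
        using \<epsilon>(2) by (force simp: PiE_iff dist_real_def abs_minus_commute)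
      ultimately show "\<exists>T. openin ?T T \<and> \<delta> \<in> T \<and> T \<subseteq> M - S" by blast
    qed
  qed
  finally show ?thesis .
qed

text \<open>
  A limit of pseudometrics is a pseudometric. Choose one point in each of its classes: on this
  transversal \<open>B\<close> the limit is a metric, and sufficiently good approximations are metrics as well,
  hence belong to \<open>F\<close>; layer-closedness applies to them. The whole of \<open>A\<close> retracts onto \<open>B\<close> without
  changing distances.
\<close>
lemma embeddable_limit:
  assumes sk: "metric_skeletoid F" and lc: "layer_closed F" and fin: "finite A"
    and approx: "\<And>\<epsilon>. \<epsilon> > 0 \<Longrightarrow> \<exists>d'. embeddable F A d' \<and> (\<forall>x\<in>A. \<forall>y\<in>A. \<bar>d' x y - d x y\<bar> < \<epsilon>)"
  shows "embeddable F A d"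
proof -
  obtain m0 where m0: "m0 \<in> F"
    using approx[of 1] unfolding embeddable_def by auto
  have refl: "d x x = 0" if "x \<in> A" for x
  proof (rule ccontr)
    assume "d x x \<noteq> 0"
    then obtain d' where "embeddable F A d'" "\<forall>x'\<in>A. \<forall>y\<in>A. \<bar>d' x' y - d x' y\<bar> < \<bar>d x x\<bar>"
      using approx[of "\<bar>d x x\<bar>"] by auto
    then show False using embeddable_pseudometric(1)[of F A d' x] that by force
  qed
  have nonneg: "0 \<le> d x y" if "x \<in> A" "y \<in> A" for x y
  proof (rule ccontr)
    assume "\<not> 0 \<le> d x y"
    then obtain d' where "embeddable F A d'" "\<forall>x'\<in>A. \<forall>y'\<in>A. \<bar>d' x' y' - d x' y'\<bar> < - d x y"
      using approx[of "- d x y"] by auto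
    then show False using embeddable_pseudometric(2)[of F A d' x y] that by force
  qed
  have sym: "d x y = d y x" if "x \<in> A" "y \<in> A" for x y
  proof (rule ccontr)
    let ?e = "\<bar>d x y - d y x\<bar> / 2"
    assume "d x y \<noteq> d y x"
    then obtain d' where d': "embeddable F A d'" "\<forall>x'\<in>A. \<forall>y'\<in>A. \<bar>d' x' y' - d x' y'\<bar> < ?e"
      using approx[of ?e] by auto
    then have "\<bar>d' x y - d x y\<bar> < ?e" "\<bar>d' y x - d y x\<bar> < ?e" using that by blast+
    then show False using embeddable_pseudometric(3)[OF d'(1) that] by argo
  qed
  have tri: "d x z \<le> d x y + d y z" if "x \<in> A" "y \<in> A" "z \<in> A" for x y z
  proof (rule ccontr)
    let ?e = "(d x z - (d x y + d y z)) / 3"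
    assume "\<not> d x z \<le> d x y + d y z"
    then obtain d' where d': "embeddable F A d'" "\<forall>x'\<in>A. \<forall>y'\<in>A. \<bar>d' x' y' - d x' y'\<bar> < ?e"
      using approx[of ?e] by auto
    then have "\<bar>d' x y - d x y\<bar> < ?e" "\<bar>d' x z - d x z\<bar> < ?e" "\<bar>d' y z - d y z\<bar> < ?e"
      using that by blast+
    then show False using embeddable_pseudometric(4)[OF d'(1) that] by argo
  qed
  define r where "r x = (SOME y. y \<in> A \<and> d x y = 0)" for x
  have r: "r x \<in> A" "d x (r x) = 0" if "x \<in> A" for x
    using someI[of "\<lambda>y. y \<in> A \<and> d x y = 0" x] refl that unfolding r_def by auto
  have r_eq: "r x = r y" if "x \<in> A" "y \<in> A" "d x y = 0" for x y
  proof -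
    have "d x z = 0 \<longleftrightarrow> d y z = 0" if "z \<in> A" for z
      using tri[of x y z] tri[of y x z] sym[of x y] nonneg[of x z] nonneg[of y z] that
        \<open>x \<in> A\<close> \<open>y \<in> A\<close> \<open>d x y = 0\<close> by auto
    then have "(\<lambda>z. z \<in> A \<and> d x z = 0) = (\<lambda>z. z \<in> A \<and> d y z = 0)" by auto
    then show ?thesis unfolding r_def by simp
  qed
  have r_d: "d (r x) (r y) = d x y" if "x \<in> A" "y \<in> A" for x y
    using tri[of x "r x" y] tri[of "r x" "r y" y] tri[of "r x" x "r y"] tri[of x y "r y"]
      r[of x] r[of y] that sym[of x "r x"] sym[of y "r y"] by simp
  define B where "B = r ` A"
  have B: "finite B" "B \<subseteq> A" using fin r by (auto simp: B_def)
  have sep: "b = c" if "b \<in> B" "c \<in> B" "d b c = 0" for b c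
    using that r_d r_eq unfolding B_def by auto
  have "embeddable F B d"
  proof (cases "card B > 1")
    case False
    then have "x = y" if "x \<in> B" "y \<in> B" for x y
      using that B(1) by (metis One_nat_def card_le_Suc0_iff_eq linorder_not_le)
    moreover obtain p where "p \<in> mspace m0"
      using skeletoid_closed(2)[OF sk m0] by blast
    ultimately show ?thesis
      using m0 B(2) refl by (intro embeddableI[where m=m0 and f="\<lambda>_. p"]) force+
  next
    case True
    define n where "n = card B"
    obtain \<beta> where \<beta>: "bij_betw \<beta> {1..n} B"
      using ex_bij_betw_nat_finite_1[OF B(1)] unfolding n_def by blast
    have \<beta>B: "\<beta> i \<in> B" "\<beta> i \<in> A" if "i \<in> {1..n}" for i
      using \<beta> B(2) that by (auto simp: bij_betw_def)
    have \<beta>inj: "\<beta> i = \<beta> j \<longleftrightarrow> i = j" if "i \<in> {1..n}" "j \<in> {1..n}" for i j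
      using \<beta> that unfolding bij_betw_def by (meson inj_on_eq_iff)
    define \<delta> where "\<delta> = restrict (\<lambda>(i, j). d (\<beta> i) (\<beta> j)) ({1..n} \<times> {1..n})"
    have \<delta>M: "\<delta> \<in> metrics_in UNIV {1..n}"
      unfolding metrics_in_def
    proof (intro CollectI conjI space_in_UNIV_I)
      show "\<delta> \<in> extensional ({1..n} \<times> {1..n})" by (simp add: \<delta>_def)
    next
      fix i j k assume "i \<in> {1..n}" "j \<in> {1..n}" "k \<in> {1..n}"
      then show "curry \<delta> i k \<le> curry \<delta> i j + curry \<delta> j k"
        using tri[of "\<beta> i" "\<beta> j" "\<beta> k"] \<beta>B by (simp add: \<delta>_def)
    next
      fix i j assume ij: "i \<in> {1..n}" "j \<in> {1..n}"
      show "0 \<le> curry \<delta> i j" "curry \<delta> i j = curry \<delta> j i"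
        using ij nonneg[of "\<beta> i" "\<beta> j"] sym[of "\<beta> i" "\<beta> j"] \<beta>B by (simp_all add: \<delta>_def)
      show "curry \<delta> i j = 0 \<longleftrightarrow> i = j"
        using ij sep[of "\<beta> i" "\<beta> j"] refl[of "\<beta> i"] \<beta>B \<beta>inj[OF ij] by (auto simp: \<delta>_def)
    qed
    \<comment> \<open>An approximation of \<open>d\<close> within \<open>\<eta>\<close> has no zero distance between different points of \<open>B\<close>.
        The number 1 only serves to make the minimum meaningful.\<close>
    define \<eta> where "\<eta> = Min (insert 1 ((\<lambda>(b, c). d b c) ` {(b, c) \<in> B \<times> B. b \<noteq> c}))"
    have finP: "finite {(b, c) \<in> B \<times> B. b \<noteq> c}"
      by (rule finite_subset[of _ "B \<times> B"]) (use B(1) in auto)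
    have pos: "d b c > 0" if "b \<in> B" "c \<in> B" "b \<noteq> c" for b c
      using sep[OF that(1,2)] nonneg[of b c] that B(2) by force
    have \<eta>0: "\<eta> > 0"
      unfolding \<eta>_def using finP pos by (subst Min_gr_iff) auto
    have \<eta>d: "\<eta> \<le> d b c" if "b \<in> B" "c \<in> B" "b \<noteq> c" for b c
      unfolding \<eta>_def using finP that by (intro Min_le) auto
    have "\<exists>\<delta>'\<in>metrics_in F {1..n}. \<forall>i\<in>{1..n} \<times> {1..n}. \<bar>\<delta>' i - \<delta> i\<bar> < \<epsilon>" if "\<epsilon> > 0" for \<epsilon>
    proof -
      have "min \<epsilon> \<eta> > 0" using that \<eta>0 by simp
      from approx[OF this] obtain d' where d': "embeddable F A d'"
        "\<And>x y. x \<in> A \<Longrightarrow> y \<in> A \<Longrightarrow> \<bar>d' x y - d x y\<bar> < min \<epsilon> \<eta>"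
        by blast
      from d'(1) obtain m f where m: "m \<in> F" "f \<in> A \<rightarrow> mspace m"
        "\<And>x y. x \<in> A \<Longrightarrow> y \<in> A \<Longrightarrow> mdist m (f x) (f y) = d' x y"
        unfolding embeddable_def by blast
      define \<delta>' where "\<delta>' = restrict (\<lambda>(i, j). d' (\<beta> i) (\<beta> j)) ({1..n} \<times> {1..n})"
      have "inj_on f B"
      proof (rule inj_onI, rule ccontr)
        fix b c assume bc: "b \<in> B" "c \<in> B" "f b = f c" "b \<noteq> c"
        have bcA: "b \<in> A" "c \<in> A" using bc B(2) by auto
        have "f b \<in> mspace m" using m(2) bcA by auto
        then have "d' b c = 0" using bc(3) m(3)[OF bcA] by (metis mdist_zero)
        then show False using d'(2)[OF bcA] \<eta>d[OF bc(1,2,4)] by linarith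
      qed
      then have "inj_on (f \<circ> \<beta>) {1..n}"
        using \<beta> by (simp add: bij_betw_def comp_inj_on)
      then have "space_in F {1..n} (curry \<delta>')"
        using \<beta>B m True
        by (intro space_inI[OF sk m(1), where \<phi>="f \<circ> \<beta>"]) (auto simp: \<delta>'_def n_def Pi_iff)
      then have "\<delta>' \<in> metrics_in F {1..n}"
        unfolding metrics_in_def by (simp add: \<delta>'_def)
      moreover have "\<forall>i\<in>{1..n} \<times> {1..n}. \<bar>\<delta>' i - \<delta> i\<bar> < \<epsilon>"
      proof clarify
        fix i j assume "i \<in> {1..n}" "j \<in> {1..n}"
        then show "\<bar>\<delta>' (i, j) - \<delta> (i, j)\<bar> < \<epsilon>"
          using d'(2)[OF \<beta>B(2) \<beta>B(2), of i j] by (simp add: \<delta>_def \<delta>'_def)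
      qed
      ultimately show ?thesis by blast
    qed
    moreover have "closedin (subtopology (product_topology (\<lambda>_. euclideanreal) ({1..n} \<times> {1..n}))
                     (metrics_in UNIV {1..n})) (metrics_in F {1..n})"
      using lc True unfolding layer_closed_def n_def by blast
    then have "\<forall>\<delta>\<in>metrics_in UNIV {1..n}.
        (\<forall>\<epsilon>>0. \<exists>\<delta>'\<in>metrics_in F {1..n}. \<forall>i\<in>{1..n} \<times> {1..n}. \<bar>\<delta>' i - \<delta> i\<bar> < \<epsilon>) \<longrightarrow>
        \<delta> \<in> metrics_in F {1..n}"
      by (subst (asm) closedin_pointwise_iff) (auto simp: metrics_in_def space_in_def)
    ultimately have "\<delta> \<in> metrics_in F {1..n}"
      using \<delta>M by blast
    then have emb: "embeddable F {1..n} (curry \<delta>)"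
      by (simp add: metrics_in_def space_in_imp_embeddable)
    have inv: "inv_into {1..n} \<beta> b \<in> {1..n}" "\<beta> (inv_into {1..n} \<beta> b) = b" if "b \<in> B" for b
      using \<beta> that by (metis bij_betw_def inv_into_into, metis bij_betw_inv_into_right)
    show ?thesis
    proof (rule embeddable_pullback[OF emb])
      show "inv_into {1..n} \<beta> \<in> B \<rightarrow> {1..n}" using inv(1) by blast
      fix b c assume "b \<in> B" "c \<in> B"
      then show "d b c = curry \<delta> (inv_into {1..n} \<beta> b) (inv_into {1..n} \<beta> c)"
        using inv[of b] inv[of c] by (simp add: \<delta>_def)
    qed
  qed
  then show ?thesis
  proof (rule embeddable_pullback)
    show "r \<in> A \<rightarrow> B" by (simp add: B_def)
    show "d x y = d (r x) (r y)" if "x \<in> A" "y \<in> A" for x y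
      using r_d[OF that] by simp
  qed
qed

section \<open>Amalgamating two one-point extensions\<close>

text \<open>
  If one of the two extra points has distance zero to a point of \<open>A\<close>, or if the two types are equal,
  then no new point is needed: the extra point can be identified with one that is already there.
  In the remaining case both extensions are proper and the types differ somewhere, which is exactly
  the hypothesis of the amalgamation property.
\<close>
lemma amalgamate_point_types:
  assumes sk: "metric_skeletoid F" and A: "finite A" "A \<noteq> {}"
    and sep: "\<And>x y. x \<in> A \<Longrightarrow> y \<in> A \<Longrightarrow> d x y = 0 \<Longrightarrow> x = y"
    and h: "point_type F A d h" and k: "point_type F A d k"
  obtains m f p q where "m \<in> F" "f \<in> A \<rightarrow> mspace m" "p \<in> mspace m" "q \<in> mspace m"
    and "\<And>x y. x \<in> A \<Longrightarrow> y \<in> A \<Longrightarrow> mdist m (f x) (f y) = d x y"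
    and "\<And>x. x \<in> A \<Longrightarrow> mdist m p (f x) = h x"
    and "\<And>x. x \<in> A \<Longrightarrow> mdist m q (f x) = k x"
proof -
  obtain m1 f1 p where m1: "m1 \<in> F" "f1 \<in> A \<rightarrow> mspace m1" "p \<in> mspace m1"
    "\<And>x y. x \<in> A \<Longrightarrow> y \<in> A \<Longrightarrow> mdist m1 (f1 x) (f1 y) = d x y"
    "\<And>x. x \<in> A \<Longrightarrow> mdist m1 p (f1 x) = h x"
    using h by (elim point_typeE) (rule that)
  obtain m2 f2 q where m2: "m2 \<in> F" "f2 \<in> A \<rightarrow> mspace m2" "q \<in> mspace m2"
    "\<And>x y. x \<in> A \<Longrightarrow> y \<in> A \<Longrightarrow> mdist m2 (f2 x) (f2 y) = d x y"
    "\<And>x. x \<in> A \<Longrightarrow> mdist m2 q (f2 x) = k x"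
    using k by (elim point_typeE) (rule that)
  consider a where "a \<in> A" "p = f1 a" | b where "b \<in> A" "q = f2 b"
    | "p \<notin> f1 ` A" "q \<notin> f2 ` A" "\<exists>c\<in>A. h c \<noteq> k c" | "\<forall>c\<in>A. h c = k c"
    by blast
  then show thesis
  proof cases
    case 1
    show thesis
      by (rule that[of m2 f2 "f2 a" q]) (use 1 m1 m2 in auto)
  next
    case 2
    show thesis
      by (rule that[of m1 f1 p "f1 b"]) (use 2 m1 m2 in auto)
  next
    case 4
    show thesis
      by (rule that[of m1 f1 p p]) (use 4 m1 in auto)
  next
    case 3
    \<comment> \<open>\<open>A\<close> is renamed to \<open>{..<n}\<close>; the extra points of types \<open>h\<close> and \<open>k\<close> become \<open>n\<close> and \<open>Suc n\<close>.\<close>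
    define n where "n = card A"
    obtain g where g: "bij_betw g A {..<n}"
      using ex_bij_betw_finite_nat[OF A(1)] unfolding n_def atLeast0LessThan by blast
    define s where "s = inv_into A g"
    have s: "s i \<in> A" "g (s i) = i" if "i < n" for i
      unfolding s_def using that g bij_betw_imp_surj_on[OF g]
      by (auto simp: inv_into_into f_inv_into_f)
    have sg: "g x < n" "s (g x) = x" if "x \<in> A" for x
      unfolding s_def using that g by (auto simp: bij_betw_def)
    define \<delta> where "\<delta> i j =
      (if i = j then 0
       else if i < n then (if j < n then d (s i) (s j) else if j = n then h (s i) else k (s i))
       else if i = n then h (s j) else k (s j))" for i j
    have copy: "space_in F (insert c {..<n}) \<delta>"
      if m: "m \<in> F" "f \<in> A \<rightarrow> mspace m" "r \<in> mspace m" "r \<notin> f ` A"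
        and f: "\<And>x y. x \<in> A \<Longrightarrow> y \<in> A \<Longrightarrow> mdist m (f x) (f y) = d x y"
        and c: "c \<ge> n" "\<And>j. j < n \<Longrightarrow> \<delta> c j = mdist m r (f (s j))" "\<And>j. j < n \<Longrightarrow> \<delta> j c = \<delta> c j"
      for m f r c
    proof (rule space_inI[OF sk m(1)])
      let ?\<phi> = "\<lambda>i. if i = c then r else f (s i)"
      have f_s: "f (s i) \<in> mspace m" if "i < n" for i
        using m(2) s that by auto
      show "?\<phi> \<in> insert c {..<n} \<rightarrow> mspace m"
        using m(3) f_s by auto
      have "f (s i) = f (s j) \<Longrightarrow> i = j" if "i < n" "j < n" for i j
      proof -
        assume "f (s i) = f (s j)"
        then have "d (s i) (s j) = 0"
          using f[of "s i" "s j"] f_s[OF that(2)] s(1) that by (metis mdist_zero)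
        then show "i = j" using sep s that by metis
      qed
      moreover have "r \<noteq> f (s i)" if "i < n" for i
        using m(4) s(1)[OF that] by blast
      ultimately show "inj_on ?\<phi> (insert c {..<n})"
        by (auto simp: inj_on_def)
      fix i j assume "i \<in> insert c {..<n}" "j \<in> insert c {..<n}"
      then consider "i = c" "j = c" | "i = c" "j < n" | "i < n" "j = c" | "i < n" "j < n" by auto
      then show "\<delta> i j = mdist m (?\<phi> i) (?\<phi> j)"
      proof cases
        case 1 then show ?thesis using m(3) by (simp add: \<delta>_def)
      next
        case 2 then show ?thesis using c by simp
      next
        case 3 then show ?thesis using c by (simp add: mdist_commute)
      next
        case 4
        moreover have "\<delta> i j = mdist m (f (s i)) (f (s j))"
        proof (cases "i = j")
          case True
          then show ?thesis using f_s[OF 4(2)] by (simp add: \<delta>_def)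
        next
          case False
          then show ?thesis using 4 f s(1) by (simp add: \<delta>_def)
        qed
        ultimately show ?thesis using c(1) by simp
      qed
    qed simp
    define V where "V = insert n (insert (Suc n) {..<n})"
    have V: "V - {Suc n} = insert n {..<n}" "V - {n} = insert (Suc n) {..<n}"
        "V - {n, Suc n} = {..<n}"
      by (auto simp: V_def)
    have "space_in F (V - {Suc n}) \<delta>"
      unfolding V by (rule copy[OF m1(1-3)]) (use 3 m1(4,5) s(1) in \<open>auto simp: \<delta>_def\<close>)
    moreover have "space_in F (V - {n}) \<delta>"
      unfolding V by (rule copy[OF m2(1-3)]) (use 3 m2(4,5) s(1) in \<open>auto simp: \<delta>_def\<close>)
    moreover have "\<forall>c\<in>V - {n, Suc n}. \<delta> n c = \<delta> c n \<and> \<delta> (Suc n) c = \<delta> c (Suc n)"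
      unfolding V by (auto simp: \<delta>_def)
    moreover have "\<exists>c\<in>V - {n, Suc n}. \<delta> n c \<noteq> \<delta> (Suc n) c"
    proof -
      obtain x where "x \<in> A" "h x \<noteq> k x" using 3(3) by blast
      then show ?thesis
        unfolding V using sg[OF \<open>x \<in> A\<close>] by (intro bexI[of _ "g x"]) (auto simp: \<delta>_def)
    qed
    moreover have "finite V" "n \<in> V" "Suc n \<in> V" "n \<noteq> Suc n"
      by (auto simp: V_def)
    ultimately have prem: "finite V \<and> n \<in> V \<and> Suc n \<in> V \<and> n \<noteq> Suc n \<and>
        space_in F (V - {n}) \<delta> \<and> space_in F (V - {Suc n}) \<delta> \<and>
        (\<forall>c\<in>V - {n, Suc n}. \<delta> n c = \<delta> c n \<and> \<delta> (Suc n) c = \<delta> c (Suc n)) \<and>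
        (\<exists>c\<in>V - {n, Suc n}. \<delta> n c \<noteq> \<delta> (Suc n) c)"
      by (intro conjI)
    have "amalgamation_property F"
      using sk by (simp add: metric_skeletoid_def)
    from this[unfolded amalgamation_property_def, THEN spec, THEN spec, THEN spec, THEN spec, THEN mp, OF prem]
    obtain \<delta>' where \<delta>': "\<forall>(x, y)\<in>V \<times> V - {(n, Suc n), (Suc n, n)}. \<delta>' x y = \<delta> x y"
        "space_in F V \<delta>'"
      by blast
    then obtain m where m: "m \<in> F" "mspace m = V" "\<And>i j. i \<in> V \<Longrightarrow> j \<in> V \<Longrightarrow> mdist m i j = \<delta>' i j"
      unfolding space_in_def by blast
    have eq: "mdist m i j = \<delta> i j" if "i \<in> V" "j \<in> V" "j < n" for i j
      using m(3)[OF that(1,2)] \<delta>'(1) that by auto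
    show thesis
    proof (rule that[OF m(1), of g n "Suc n"])
      show "g \<in> A \<rightarrow> mspace m" "n \<in> mspace m" "Suc n \<in> mspace m"
        using sg by (auto simp: m(2) V_def)
      show "mdist m (g x) (g y) = d x y" if "x \<in> A" "y \<in> A" for x y
      proof (cases "x = y")
        case True
        then have "d x y = 0" using m1(4)[OF that] funcset_mem[OF m1(2) that(1)] mdist_zero[of "f1 x" m1 "f1 x"] by simp
        then show ?thesis using True sg[OF that(1)] by (simp add: m(2) V_def)
      next
        case False
        then have "g x \<noteq> g y" using sg that by metis
        then show ?thesis
          using sg that by (subst eq) (auto simp: V_def \<delta>_def)
      qed
      show "mdist m n (g x) = h x" "mdist m (Suc n) (g x) = k x" if "x \<in> A" for x
        using sg[OF that] by (auto simp: eq V_def \<delta>_def)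
    qed
  qed
qed

section \<open>Spaces with a prescribed age\<close>

definition age_in :: "nat metric set \<Rightarrow> 'b metric \<Rightarrow> bool" where
  "age_in F X \<longleftrightarrow> (\<forall>A. finite A \<and> A \<subseteq> mspace X \<longrightarrow> embeddable F A (mdist X))"

text \<open>
  Only types over the whole space are required to be realized; this is what maximality yields
  directly. Types over subsets are handled by \<open>realize_point_type\<close>.
\<close>
definition saturated :: "nat metric set \<Rightarrow> 'b metric \<Rightarrow> bool" where
  "saturated F X \<longleftrightarrow> age_in F X \<and>
     (\<forall>h. (\<forall>A. finite A \<and> A \<subseteq> mspace X \<longrightarrow> point_type F A (mdist X) h) \<longrightarrow>
          (\<exists>x\<in>mspace X. \<forall>y\<in>mspace X. mdist X x y = h y))"

lemma age_inD: "age_in F X \<Longrightarrow> finite A \<Longrightarrow> A \<subseteq> mspace X \<Longrightarrow> embeddable F A (mdist X)"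
  by (simp add: age_in_def)

lemma saturated_imp_age_in: "saturated F X \<Longrightarrow> age_in F X"
  by (simp add: saturated_def)

lemma saturatedI:
  assumes "age_in F X"
    and "\<And>h. (\<And>A. finite A \<Longrightarrow> A \<subseteq> mspace X \<Longrightarrow> point_type F A (mdist X) h) \<Longrightarrow>
           \<exists>x\<in>mspace X. \<forall>y\<in>mspace X. mdist X x y = h y"
  shows "saturated F X"
  using assms by (simp add: saturated_def)

lemma saturatedD:
  assumes "saturated F X"
    and "\<And>A. finite A \<Longrightarrow> A \<subseteq> mspace X \<Longrightarrow> point_type F A (mdist X) h"
  shows "\<exists>x\<in>mspace X. \<forall>y\<in>mspace X. mdist X x y = h y"
  using assms by (simp add: saturated_def)

lemma point_type_limit:
  assumes "metric_skeletoid F" "layer_closed F" "finite A"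
    and "\<And>\<epsilon>. \<epsilon> > 0 \<Longrightarrow> \<exists>d' h'. point_type F A d' h' \<and>
           (\<forall>x\<in>A. \<forall>y\<in>A. \<bar>d' x y - d x y\<bar> < \<epsilon>) \<and> (\<forall>x\<in>A. \<bar>h' x - h x\<bar> < \<epsilon>)"
  shows "point_type F A d h"
  unfolding point_type_iff_embeddable
proof (rule embeddable_limit[OF assms(1,2)])
  show "finite (insert None (Some ` A))" using assms(3) by simp
  fix \<epsilon> :: real assume \<epsilon>: "\<epsilon> > 0"
  then obtain d' h' where dh: "point_type F A d' h'" "\<forall>x\<in>A. \<forall>y\<in>A. \<bar>d' x y - d x y\<bar> < \<epsilon>" "\<forall>x\<in>A. \<bar>h' x - h x\<bar> < \<epsilon>"
    using assms(4) by blast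
  then show "\<exists>D. embeddable F (insert None (Some ` A)) D \<and>
      (\<forall>u\<in>insert None (Some ` A). \<forall>v\<in>insert None (Some ` A). \<bar>D u v - adjoin d h u v\<bar> < \<epsilon>)"
    using \<epsilon> by (intro exI[of _ "adjoin d' h'"]) (auto simp: adjoin_def point_type_iff_embeddable)
qed

text \<open>
  Extend \<open>h\<close> to a point type over all of \<open>X\<close> and realize that one. Partial types are represented by
  their graphs: a set \<open>R\<close> of pairs (point, value) is a partial type if each of its finite subsets
  is realized in \<open>F\<close>, where the distance of two pairs is the distance of the points and the type is
  the projection \<open>snd\<close>. Such a set is automatically single-valued, and the property passes to unions
  of chains.
\<close>
lemma realize_point_type:
  fixes X :: "'b metric"
  assumes sk: "metric_skeletoid F" and lc: "layer_closed F" and sat: "saturated F X"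
    and S: "S \<subseteq> mspace X" "S \<noteq> {}"
    and type: "\<And>A. finite A \<Longrightarrow> A \<subseteq> S \<Longrightarrow> point_type F A (mdist X) h"
  obtains x where "x \<in> mspace X" "\<And>s. s \<in> S \<Longrightarrow> mdist X x s = h s"
proof -
  let ?d = "\<lambda>a b :: 'b \<times> real. mdist X (fst a) (fst b)"
  define G where "G = (\<lambda>s. (s, h s)) ` S"
  define \<R> where "\<R> = {R. G \<subseteq> R \<and> fst ` R \<subseteq> mspace X \<and>
      (\<forall>R'. finite R' \<and> R' \<subseteq> R \<longrightarrow> point_type F R' ?d snd)}"
  have RD: "G \<subseteq> R" "fst ` R \<subseteq> mspace X"
      "\<And>R'. finite R' \<Longrightarrow> R' \<subseteq> R \<Longrightarrow> point_type F R' ?d snd" if "R \<in> \<R>" for R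
    using that unfolding \<R>_def by blast+
  have "G \<in> \<R>"
  proof -
    have "point_type F R' ?d snd" if "finite R'" "R' \<subseteq> G" for R'
    proof (rule point_type_pullback[OF type, where g=fst])
      show "finite (fst ` R')" "fst ` R' \<subseteq> S" using that by (auto simp: G_def)
      show "snd a = h (fst a)" if "a \<in> R'" for a
        using that \<open>R' \<subseteq> G\<close> by (auto simp: G_def)
    qed auto
    then show ?thesis using S(1) by (auto simp: \<R>_def G_def)
  qed
  have "\<exists>R\<in>\<R>. \<forall>R'\<in>\<R>. R \<subseteq> R' \<longrightarrow> R' = R"
  proof (rule subset_Zorn_nonempty)
    show "\<R> \<noteq> {}" using \<open>G \<in> \<R>\<close> by blast
    fix C assume C: "C \<noteq> {}" "subset.chain \<R> C"
    then have sub: "C \<subseteq> \<R>" by (simp add: subset_chain_def)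
    have "point_type F R' ?d snd" if "finite R'" "R' \<subseteq> \<Union>C" for R'
    proof -
      from that C obtain R where "R \<in> C" "R' \<subseteq> R"
        by (rule finite_subset_Union_chain)
      then show ?thesis using RD(3) sub that(1) by blast
    qed
    moreover have "G \<subseteq> \<Union>C" "fst ` \<Union>C \<subseteq> mspace X"
      using RD(1,2) sub C(1) by blast+
    ultimately show "\<Union>C \<in> \<R>" by (simp add: \<R>_def)
  qed
  then obtain R where "R \<in> \<R>" and max: "\<And>R'. R' \<in> \<R> \<Longrightarrow> R \<subseteq> R' \<Longrightarrow> R' = R" by blast
  note R = RD[OF \<open>R \<in> \<R>\<close>]
  have single: "t = u" if "(x, t) \<in> R" "(x, u) \<in> R" for x t u
  proof -
    have "x \<in> mspace X" using R(2) that by force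
    moreover have "point_type F {(x, t), (x, u)} ?d snd" using R(3) that by simp
    then obtain m f p where "m \<in> F" and m: "f \<in> {(x, t), (x, u)} \<rightarrow> mspace m"
      "\<forall>a\<in>{(x, t), (x, u)}. \<forall>b\<in>{(x, t), (x, u)}. mdist m (f a) (f b) = ?d a b"
      "\<forall>a\<in>{(x, t), (x, u)}. mdist m p (f a) = snd a"
      unfolding point_type_def by blast
    then have "mdist m (f (x, t)) (f (x, u)) = mdist X x x" by simp
    moreover have "mdist X x x = 0" using \<open>x \<in> mspace X\<close> by simp
    ultimately have "f (x, t) = f (x, u)" using m(1) mdist_zero[of "f (x, t)" m "f (x, u)"] by simp
    then show ?thesis using m(3) by simp
  qed
  obtain s0 where s0: "s0 \<in> S" using S(2) by blast
  define a0 where "a0 = (s0, h s0)"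
  have a0: "a0 \<in> R" using R(1) s0 by (auto simp: a0_def G_def)
  have total: "x \<in> fst ` R" if x: "x \<in> mspace X" for x
  proof (rule ccontr)
    assume x_new: "x \<notin> fst ` R"
    \<comment> \<open>The values at \<open>x\<close> that are admissible as far as the finite part \<open>R'\<close> of the type can tell.\<close>
    define T where "T R' = {t. point_type F (insert (x, t) R') ?d snd}" for R'
    have T_mono: "T R2 \<subseteq> T R1" if "R1 \<subseteq> R2" for R1 R2
      unfolding T_def using point_type_subset[OF _ insert_mono[OF that]] by blast
    have T_closed: "closed (T R')" if R': "finite R'" "R' \<subseteq> R" for R'
    proof -
      have "t \<in> T R'" if t: "\<forall>e>0. \<exists>t'\<in>T R'. dist t' t < e" for t
        unfolding T_def mem_Collect_eq
      proof (rule point_type_limit[OF sk lc])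
        fix \<epsilon> :: real assume "\<epsilon> > 0"
        then obtain t' where t': "t' \<in> T R'" "\<bar>t' - t\<bar> < \<epsilon>"
          using t by (auto simp: dist_real_def)
        let ?g = "\<lambda>a. if fst a = x then (x, t') else a"
        have g: "?g \<in> insert (x, t) R' \<rightarrow> insert (x, t') R'" by auto
        have "point_type F (insert (x, t) R') ?d (snd \<circ> ?g)"
          by (rule point_type_pullback[OF _ g]) (use t'(1) in \<open>auto simp: T_def\<close>)
        moreover have "\<forall>a\<in>insert (x, t) R'. \<bar>(snd \<circ> ?g) a - snd a\<bar> < \<epsilon>"
          using t'(2) \<open>\<epsilon> > 0\<close> x_new R'(2) by force
        ultimately show "\<exists>d' h'. point_type F (insert (x, t) R') d' h' \<and>
           (\<forall>a\<in>insert (x, t) R'. \<forall>b\<in>insert (x, t) R'. \<bar>d' a b - ?d a b\<bar> < \<epsilon>) \<and>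
           (\<forall>a\<in>insert (x, t) R'. \<bar>h' a - snd a\<bar> < \<epsilon>)"
          using \<open>\<epsilon> > 0\<close> by (intro exI[of _ ?d] exI[of _ "snd \<circ> ?g"]) simp
      qed (use R'(1) in simp)
      then show ?thesis
        unfolding closure_subset_eq[symmetric] by (auto simp: closure_approachable)
    qed
    have T_bounded: "bounded (T R')" if "a0 \<in> R'" for R'
    proof -
      have "\<bar>t\<bar> \<le> h s0 + mdist X s0 x" if "t \<in> T R'" for t
      proof -
        have "point_type F {(x, t), a0} ?d snd"
          using that \<open>a0 \<in> R'\<close> unfolding T_def by (auto intro: point_type_subset)
        then obtain m f p where "m \<in> F" and m: "f \<in> {(x, t), a0} \<rightarrow> mspace m" "p \<in> mspace m"
          "\<forall>a\<in>{(x, t), a0}. \<forall>b\<in>{(x, t), a0}. mdist m (f a) (f b) = ?d a b"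
          "\<forall>a\<in>{(x, t), a0}. mdist m p (f a) = snd a"
          unfolding point_type_def by blast
        then have "f (x, t) \<in> mspace m" "f a0 \<in> mspace m"
          "mdist m (f a0) (f (x, t)) = mdist X s0 x" "mdist m p (f (x, t)) = t" "mdist m p (f a0) = h s0"
          by (auto simp: a0_def)
        with m(2) have "0 \<le> t" "t \<le> h s0 + mdist X s0 x"
          using mdist_nonneg[of m p "f (x, t)"] mdist_triangle[of p m "f a0" "f (x, t)"] by auto
        then show ?thesis by simp
      qed
      then show ?thesis by (intro boundedI[of _ "h s0 + mdist X s0 x"]) auto
    qed
    have T_nonempty: "T R' \<noteq> {}" if R': "finite R'" "R' \<subseteq> R" "a0 \<in> R'" for R'
    proof -
      have fsub: "fst ` R' \<subseteq> mspace X" using R(2) R'(2) by blast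
      \<comment> \<open>The two one-point extensions of \<open>R'\<close> are the type in question and the point \<open>x\<close> of \<open>X\<close>. The
          distance of the extra points in an amalgam is an admissible value.\<close>
      have sep: "a = b" if "a \<in> R'" "b \<in> R'" "?d a b = 0" for a b
      proof -
        have "fst a \<in> mspace X" "fst b \<in> mspace X" using that fsub by auto
        then have "fst a = fst b" using that(3) by simp
        have ab: "(fst a, snd a) \<in> R" "(fst b, snd b) \<in> R"
          using subsetD[OF R'(2) that(1)] subsetD[OF R'(2) that(2)] by simp_all
        have "snd a = snd b"
          by (rule single[OF ab(1)]) (simp only: ab(2) \<open>fst a = fst b\<close>)
        with \<open>fst a = fst b\<close> show ?thesis by (rule prod_eqI)
      qed
      have "embeddable F (insert x (fst ` R')) (mdist X)"
        using R'(1) fsub x by (intro age_inD[OF saturated_imp_age_in[OF sat]]) auto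
      then obtain m f where m: "m \<in> F" "f \<in> insert x (fst ` R') \<rightarrow> mspace m"
        "\<And>y z. y \<in> insert x (fst ` R') \<Longrightarrow> z \<in> insert x (fst ` R') \<Longrightarrow> mdist m (f y) (f z) = mdist X y z"
        unfolding embeddable_def by blast
      have type_x: "point_type F R' ?d (\<lambda>a. mdist X x (fst a))"
        by (rule point_typeI[OF m(1), where f="f \<circ> fst" and p="f x"]) (use m(2,3) in \<open>auto simp: Pi_iff\<close>)
      show ?thesis
      proof (rule amalgamate_point_types[OF sk R'(1), of ?d snd "\<lambda>a. mdist X x (fst a)"])
        show "R' \<noteq> {}" using R'(3) by blast
        show "a = b" if "a \<in> R'" "b \<in> R'" "?d a b = 0" for a b using sep that .
        show "point_type F R' ?d snd" using R(3) R'(1,2) .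
        show "point_type F R' ?d (\<lambda>a. mdist X x (fst a))" by (rule type_x)
      next
        fix m f p q
        assume m: "m \<in> F" "f \<in> R' \<rightarrow> mspace m" "p \<in> mspace m" "q \<in> mspace m"
          "\<And>a b. a \<in> R' \<Longrightarrow> b \<in> R' \<Longrightarrow> mdist m (f a) (f b) = ?d a b"
          "\<And>a. a \<in> R' \<Longrightarrow> mdist m p (f a) = snd a"
          "\<And>a. a \<in> R' \<Longrightarrow> mdist m q (f a) = mdist X x (fst a)"
        have "point_type F (insert (x, mdist m p q) R') ?d snd"
        proof (rule point_typeI[OF m(1), where f="\<lambda>a. if fst a = x then q else f a" and p=p])
          have ne: "fst a \<noteq> x" if "a \<in> R'" for a
            using x_new R'(2) that by blast
          show "(\<lambda>a. if fst a = x then q else f a) \<in> insert (x, mdist m p q) R' \<rightarrow> mspace m"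
            using m(2,4) by auto
          show "mdist m (if fst a = x then q else f a) (if fst b = x then q else f b) = ?d a b"
            if "a \<in> insert (x, mdist m p q) R'" "b \<in> insert (x, mdist m p q) R'" for a b
          proof -
            have "mdist m (f a) q = mdist X (fst a) x" if "a \<in> R'" for a
              using m(7)[OF that] by (metis mdist_commute)
            moreover have "mdist m q q = 0" "mdist X x x = 0" using m(4) x by simp_all
            ultimately show ?thesis
              using that m(5)[of a b] m(7)[of b] ne[of a] ne[of b]
              by (cases "a \<in> R'"; cases "b \<in> R'") simp_all
          qed
          show "mdist m p (if fst a = x then q else f a) = snd a"
            if "a \<in> insert (x, mdist m p q) R'" for a
            using that ne[of a] m(6)[of a] by auto
        qed (rule m(3))
        then show "T R' \<noteq> {}" unfolding T_def by blast
      qed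
    qed
    define \<T> where "\<T> = {T R' |R'. finite R' \<and> R' \<subseteq> R \<and> a0 \<in> R'}"
    have "\<Inter>\<T> \<noteq> {}"
    proof -
      have cpt: "compact K" if "K \<in> \<T>" for K
        using that T_closed T_bounded unfolding \<T>_def compact_eq_bounded_closed by blast
      have T0: "T {a0} \<in> \<T>" using a0 unfolding \<T>_def by blast
      have fip: "\<Inter>\<F> \<noteq> {}" if "finite \<F>" "\<F> \<subseteq> \<T>" "\<F> \<noteq> {}" for \<F>
      proof -
        from that(1,3,2) have "\<exists>R'. finite R' \<and> R' \<subseteq> R \<and> a0 \<in> R' \<and> T R' \<subseteq> \<Inter>\<F>"
        proof (induction \<F> rule: finite_ne_induct)
          case (singleton K)
          then show ?case unfolding \<T>_def by blast
        next
          case (insert K \<F>)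
          then obtain R1 where R1: "finite R1" "R1 \<subseteq> R" "a0 \<in> R1" "T R1 \<subseteq> \<Inter>\<F>" by auto
          obtain R2 where R2: "finite R2" "R2 \<subseteq> R" "K = T R2"
            using insert.prems unfolding \<T>_def by auto
          have "T (R1 \<union> R2) \<subseteq> T R1" "T (R1 \<union> R2) \<subseteq> T R2"
            by (rule T_mono, simp)+
          with R1(4) R2(3) have "T (R1 \<union> R2) \<subseteq> \<Inter>(insert K \<F>)" by auto
          then show ?case
            using R1(1-3) R2(1,2) by (intro exI[of _ "R1 \<union> R2"]) simp
        qed
        then obtain R' where "finite R'" "R' \<subseteq> R" "a0 \<in> R'" "T R' \<subseteq> \<Inter>\<F>" by blast
        then show ?thesis using T_nonempty[of R'] by auto
      qed
      have "T {a0} \<inter> \<Inter>\<T> \<noteq> {}"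
      proof (rule compact_imp_fip)
        show "compact (T {a0})" using cpt T0 by blast
        show "closed K" if "K \<in> \<T>" for K using cpt[OF that] by (rule compact_imp_closed)
        show "T {a0} \<inter> \<Inter>\<F> \<noteq> {}" if "finite \<F>" "\<F> \<subseteq> \<T>" for \<F>
          using fip[of "insert (T {a0}) \<F>"] that T0 by simp
      qed
      then show ?thesis by blast
    qed
    then obtain t where "t \<in> \<Inter>\<T>" by blast
    then have t: "point_type F (insert (x, t) R') ?d snd" if "finite R'" "R' \<subseteq> R" "a0 \<in> R'" for R'
      using that unfolding \<T>_def T_def by blast
    have "insert (x, t) R \<in> \<R>"
    proof -
      have "point_type F R' ?d snd" if "finite R'" "R' \<subseteq> insert (x, t) R" for R'
        by (rule point_type_subset[OF t[of "insert a0 (R' - {(x, t)})"]]) (use that a0 in auto)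
      moreover have "G \<subseteq> insert (x, t) R" "fst ` insert (x, t) R \<subseteq> mspace X"
        using R(1,2) x by auto
      ultimately show ?thesis by (simp add: \<R>_def)
    qed
    from max[OF this] have "(x, t) \<in> R" by auto
    then show False using x_new by force
  qed
  define k where "k x = (THE t. (x, t) \<in> R)" for x
  have k: "k x = t" if "(x, t) \<in> R" for x t
    unfolding k_def using single that by blast
  have kR: "(x, k x) \<in> R" if "x \<in> mspace X" for x
    using total[OF that] k by force
  have "point_type F A (mdist X) k" if "finite A" "A \<subseteq> mspace X" for A
    by (rule point_type_pullback[OF R(3)[of "(\<lambda>y. (y, k y)) ` A"], where g="\<lambda>y. (y, k y)"])
      (use that kR in \<open>auto simp: subset_iff\<close>)
  then obtain x where "x \<in> mspace X" "\<And>y. y \<in> mspace X \<Longrightarrow> mdist X x y = k y"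
    using sat unfolding saturated_def by blast
  moreover have "k s = h s" if "s \<in> S" for s
    using k[of s "h s"] R(1) that by (auto simp: G_def)
  ultimately show thesis
    using that S(1) by (metis subsetD)
qed

section \<open>Total boundedness and cardinality\<close>

text \<open>
  An \<open>\<epsilon>\<close>-separated subset of \<open>S\<close> is a copy of a member of \<open>F\<close> with distances between \<open>\<epsilon>\<close> and \<open>r\<close>, so the sizes of
  such subsets are bounded; one of maximal size is an \<open>\<epsilon>\<close>-net.
\<close>
lemma age_in_finite_net:
  assumes sk: "metric_skeletoid F" and sb: "size_bounded F" and age: "age_in F X"
    and "\<epsilon> > 0" and S: "S \<subseteq> mspace X" "\<And>x y. x \<in> S \<Longrightarrow> y \<in> S \<Longrightarrow> mdist X x y \<le> r"
  obtains K where "finite K" "K \<subseteq> S" "\<And>x. x \<in> S \<Longrightarrow> \<exists>k\<in>K. mdist X x k < \<epsilon>"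
proof -
  define N where "N = nat \<lceil>max r (1 / \<epsilon>)\<rceil> + 2"
  have "real N \<ge> max r (1 / \<epsilon>)"
    unfolding N_def by linarith
  then have N: "N > 1" "r \<le> real N" "1 / real N \<le> \<epsilon>"
    using \<open>\<epsilon> > 0\<close> by (auto simp: N_def field_simps)
  obtain \<mu> where \<mu>: "\<And>m. m \<in> F \<Longrightarrow> (\<forall>x\<in>mspace m. \<forall>y\<in>mspace m. mdist m x y > 0 \<longrightarrow>
        mdist m x y \<in> {1 / real N..real N}) \<Longrightarrow> card (mspace m) \<le> \<mu>"
    using sb[unfolded size_bounded_def, rule_format, OF N(1)] by blast
  define P where "P K \<longleftrightarrow> finite K \<and> K \<subseteq> S \<and> (\<forall>x\<in>K. \<forall>y\<in>K. x \<noteq> y \<longrightarrow> \<epsilon> \<le> mdist X x y)" for K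
  have card: "card K \<le> \<mu>" if "P K" for K
  proof (cases "K = {}")
    case False
    have K: "finite K" "K \<subseteq> mspace X" using that S(1) by (auto simp: P_def)
    obtain m f where m: "m \<in> F" "f \<in> K \<rightarrow> mspace m" "\<forall>x\<in>K. \<forall>y\<in>K. mdist m (f x) (f y) = mdist X x y"
      using age_inD[OF age K] unfolding embeddable_def by blast
    have inj: "inj_on f K"
    proof (rule inj_onI)
      fix x y assume xy: "x \<in> K" "y \<in> K" "f x = f y"
      have "mdist X x y = mdist m (f x) (f y)" using m(3) xy(1,2) by simp
      also have "\<dots> = 0" using xy m(2) by (simp add: Pi_iff)
      finally have "mdist X x y = 0" .
      then show "x = y" using xy K(2) by (simp add: subset_iff)
    qed
    have "f ` K \<subseteq> mspace m" using m(2) by auto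
    then have "submetric m (f ` K) \<in> F" "mspace (submetric m (f ` K)) = f ` K"
      using skeletoid_closed(3)[OF sk m(1)] False by auto
    moreover have "mdist m (f x) (f y) \<in> {1 / real N..real N}"
      if "x \<in> K" "y \<in> K" "mdist m (f x) (f y) > 0" for x y
    proof -
      have "mdist m (f x) (f x) = 0" using that(1) m(2) by (simp add: Pi_iff)
      then have "x \<noteq> y" using that(3) by auto
      then have "\<epsilon> \<le> mdist X x y" "mdist X x y \<le> r"
        using \<open>P K\<close> that S(2)[of x y] by (auto simp: P_def)
      then show ?thesis using that m(3) N by simp
    qed
    ultimately have "card (f ` K) \<le> \<mu>"
      using \<mu>[of "submetric m (f ` K)"] by auto
    then show ?thesis using inj by (simp add: card_image)
  qed simp
  have "P {}" by (simp add: P_def)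
  moreover have "\<forall>K. P K \<longrightarrow> card K < Suc \<mu>" using card by (simp add: less_Suc_eq_le)
  ultimately have "\<exists>K. P K \<and> (\<forall>K'. P K' \<longrightarrow> card K' \<le> card K)"
    by (rule ex_has_greatest_nat)
  then obtain K where K: "P K" "\<forall>K'. P K' \<longrightarrow> card K' \<le> card K"
    by blast
  show thesis
  proof (rule that)
    show "finite K" "K \<subseteq> S" using K(1) by (auto simp: P_def)
    fix x assume x: "x \<in> S"
    show "\<exists>k\<in>K. mdist X x k < \<epsilon>"
    proof (rule ccontr)
      assume "\<not> ?thesis"
      then have far: "\<epsilon> \<le> mdist X x k" if "k \<in> K" for k using that by force
      moreover have "\<epsilon> \<le> mdist X k x" if "k \<in> K" for k
        using far[OF that] by (metis mdist_commute)
      ultimately have "P (insert x K)" using K(1) x by (auto simp: P_def)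
      moreover have "mdist X x x = 0" using x S(1) by auto
      then have "x \<notin> K" using far[of x] \<open>\<epsilon> > 0\<close> by auto
      ultimately show False using K(2)[rule_format, of "insert x K"] K(1) by (simp add: P_def)
    qed
  qed
qed

text \<open>
  Finite nets of the balls about a fixed point form a countable dense set \<open>D\<close>, and a point is
  determined by the set of pairs \<open>(z, i)\<close> with \<open>z \<in> D\<close> at distance less than \<open>1 / (i + 1)\<close> from it.
\<close>
lemma age_in_lepoll:
  assumes sk: "metric_skeletoid F" and sb: "size_bounded F" and age: "age_in F X"
  shows "mspace X \<lesssim> (UNIV :: nat set set)"
proof (cases "mspace X = {}")
  case False
  then obtain p where p: "p \<in> mspace X" by blast
  have "\<exists>K. finite K \<and> K \<subseteq> mcball_of X p (real N) \<and>
      (\<forall>x\<in>mcball_of X p (real N). \<exists>k\<in>K. mdist X x k < 1 / real (Suc N))" for N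
  proof (rule age_in_finite_net[OF sk sb age, of "1 / real (Suc N)" "mcball_of X p (real N)" "2 * real N"])
    fix x y assume "x \<in> mcball_of X p (real N)" "y \<in> mcball_of X p (real N)"
    then show "mdist X x y \<le> 2 * real N"
      using mdist_triangle[of x X p y] by (simp add: mdist_commute[of X x p])
  qed auto
  then obtain K where K: "\<And>N. finite (K N)" "\<And>N. K N \<subseteq> mcball_of X p (real N)"
    "\<And>N x. x \<in> mcball_of X p (real N) \<Longrightarrow> \<exists>k\<in>K N. mdist X x k < 1 / real (Suc N)"
    by metis
  define D where "D = (\<Union>N. K N)"
  have "K N \<subseteq> mspace X" for N using K(2)[of N] by auto
  then have D: "countable D" "D \<subseteq> mspace X"
    using K(1) unfolding D_def by (auto simp: countable_finite)
  have dense: "\<exists>z\<in>D. mdist X x z < e" if x: "x \<in> mspace X" "e > 0" for x e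
  proof -
    define N where "N = nat \<lceil>max (mdist X p x) (1 / e)\<rceil>"
    have "real N \<ge> max (mdist X p x) (1 / e)"
      unfolding N_def by linarith
    then have N: "mdist X p x \<le> real N" "1 / real (Suc N) < e"
      using x(2) by (auto simp: field_simps)
    then obtain k where "k \<in> K N" "mdist X x k < 1 / real (Suc N)"
      using K(3)[of x N] x(1) p by auto
    then show ?thesis
      using N(2) unfolding D_def by (intro bexI[of _ k]) auto
  qed
  define C where "C = D \<times> (UNIV :: nat set)"
  have "countable C" using D(1) by (simp add: C_def)
  then have inj: "inj_on (to_nat_on C) C" by (rule inj_on_to_nat_on)
  define near where "near x = {(z, i) \<in> C. mdist X x z < 1 / real (Suc i)}" for x
  have "inj_on (\<lambda>x. to_nat_on C ` near x) (mspace X)"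
  proof (rule inj_onI, rule ccontr)
    fix x y assume xy: "x \<in> mspace X" "y \<in> mspace X" "x \<noteq> y"
      and eq: "to_nat_on C ` near x = to_nat_on C ` near y"
    have near: "near x = near y"
      using inj_on_image_eq_iff[OF inj, of "near x" "near y"] eq by (auto simp: near_def)
    have "mdist X x y > 0"
      using mdist_zero[OF xy(1,2)] mdist_nonneg[of X x y] xy(3) by linarith
    then obtain i where i: "1 / real (Suc i) < mdist X x y / 2"
      using nat_approx_posE[of "mdist X x y / 2"] by auto
    obtain z where z: "z \<in> D" "mdist X x z < 1 / real (Suc i)"
      using dense[OF xy(1), of "1 / real (Suc i)"] by auto
    then have "(z, i) \<in> near x" by (simp add: near_def C_def)
    then have "mdist X y z < 1 / real (Suc i)"
      unfolding near by (simp add: near_def)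
    moreover have "mdist X x y \<le> mdist X x z + mdist X z y"
      using xy z(1) D(2) by (intro mdist_triangle) auto
    ultimately show False
      using z(2) i by (simp add: mdist_commute[of X z y])
  qed
  then show ?thesis
    unfolding lepoll_def by (intro exI conjI) auto
qed simp

section \<open>Existence of saturated spaces\<close>

text \<open>
  The metric axioms concern at most three points, so a distance that separates points is a metric
  as soon as its finite parts embed in metric spaces.
\<close>
lemma metric_of_age:
  assumes emb: "\<And>A. finite A \<Longrightarrow> A \<subseteq> X \<Longrightarrow> embeddable F A d"
    and sep: "\<And>x y. x \<in> X \<Longrightarrow> y \<in> X \<Longrightarrow> d x y = 0 \<Longrightarrow> x = y"
  shows "\<exists>M. mspace M = X \<and> (\<forall>x\<in>X. \<forall>y\<in>X. mdist M x y = d x y) \<and> age_in F M"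
proof -
  let ?d = "\<lambda>x y. if x \<in> X \<and> y \<in> X then d x y else 0"
  have ms: "Metric_space X ?d"
  proof
    fix x y z
    show "0 \<le> ?d x y" "?d x y = ?d y x"
      using embeddable_pseudometric(2,3)[OF emb[of "{x, y}"], of x y] by auto
    assume "x \<in> X" "y \<in> X"
    then show "?d x y = 0 \<longleftrightarrow> x = y"
      using embeddable_pseudometric(1)[OF emb[of "{x}"], of x] sep by auto
    assume "z \<in> X"
    then show "?d x z \<le> ?d x y + ?d y z"
      using embeddable_pseudometric(4)[OF emb[of "{x, y, z}"], of x y z] \<open>x \<in> X\<close> \<open>y \<in> X\<close> by auto
  qed
  define M where "M = metric (X, ?d)"
  have M: "mspace M = X" "mdist M = ?d"
    unfolding M_def using Metric_space.mspace_metric[OF ms] Metric_space.mdist_metric[OF ms] by auto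
  have "embeddable F A (mdist M)" if "finite A" "A \<subseteq> X" for A
    by (rule embeddable_pullback[OF emb[OF that], where g="\<lambda>x. x"]) (use that(2) M(2) in auto)
  then show ?thesis
    using M by (intro exI[of _ M]) (auto simp: age_in_def)
qed

text \<open>
  Zorn's lemma for inclusion of sets is applied to metric spaces through these graphs:
  \<open>distance_graph X \<subseteq> distance_graph Y\<close> says that \<open>X\<close> is a subspace of \<open>Y\<close>.
\<close>
definition distance_graph :: "'b metric \<Rightarrow> (('b \<times> 'b) \<times> real) set" where
  "distance_graph X = (\<lambda>(x, y). ((x, y), mdist X x y)) ` (mspace X \<times> mspace X)"

lemma in_distance_graph [simp]:
  "((x, y), r) \<in> distance_graph X \<longleftrightarrow> x \<in> mspace X \<and> y \<in> mspace X \<and> r = mdist X x y"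
  by (auto simp: distance_graph_def)

text \<open>
  Being an \<open>F\<close>-space is a condition on finite subsets, and a finite subset of the union of a chain
  lies in one of its members.
\<close>
lemma distance_graph_chain_Union:
  assumes C: "C \<noteq> {}" "subset.chain {distance_graph X |X. age_in F X} C"
  shows "\<Union>C \<in> {distance_graph X |X. age_in F X}"
proof -
  have "\<forall>G\<in>C. \<exists>X. G = distance_graph X \<and> age_in F X"
    using C(2) unfolding subset_chain_def by blast
  then obtain M where M: "\<And>G. G \<in> C \<Longrightarrow> G = distance_graph (M G)" "\<And>G. G \<in> C \<Longrightarrow> age_in F (M G)"
    by metis
  have inG: "((x, y), r) \<in> G \<longleftrightarrow> x \<in> mspace (M G) \<and> y \<in> mspace (M G) \<and> r = mdist (M G) x y"
    if "G \<in> C" for G x y r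
    using in_distance_graph[of x y r "M G"] M(1)[OF that] by simp
  define X where "X = (\<Union>G\<in>C. mspace (M G))"
  define d where "d x y = (THE r. ((x, y), r) \<in> \<Union>C)" for x y
  have d: "d x y = mdist (M G) x y" if "G \<in> C" "x \<in> mspace (M G)" "y \<in> mspace (M G)" for G x y
    unfolding d_def
  proof (rule the_equality)
    show G: "((x, y), mdist (M G) x y) \<in> \<Union>C" using that inG by blast
    fix r assume "((x, y), r) \<in> \<Union>C"
    then obtain G' where G': "G' \<in> C" "((x, y), r) \<in> G'" by blast
    have "G \<subseteq> G' \<or> G' \<subseteq> G" using C(2) that(1) G'(1) unfolding subset_chain_def by blast
    then show "r = mdist (M G) x y"
      using that inG[OF that(1)] inG[OF G'(1)] G'(2) by (metis subsetD)
  qed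
  have ex: "\<exists>G\<in>C. A \<subseteq> mspace (M G)" if "finite A" "A \<subseteq> X" for A
  proof -
    have "finite ((\<lambda>x. ((x, x), 0 :: real)) ` A)" using that(1) by simp
    moreover have "(\<lambda>x. ((x, x), 0 :: real)) ` A \<subseteq> \<Union>C"
      using that(2) inG unfolding X_def by force
    ultimately obtain G where "G \<in> C" "(\<lambda>x. ((x, x), 0 :: real)) ` A \<subseteq> G"
      using C by (rule finite_subset_Union_chain)
    then show ?thesis using inG by (intro bexI[of _ G]) auto
  qed
  have emb: "embeddable F A d" if A: "finite A" "A \<subseteq> X" for A
  proof -
    obtain G where G: "G \<in> C" "A \<subseteq> mspace (M G)" using ex[OF A] by blast
    show ?thesis
      by (rule embeddable_pullback[OF age_inD[OF M(2)[OF G(1)] A(1) G(2)], where g="\<lambda>x. x"])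
        (use d[OF G(1)] G(2) in auto)
  qed
  have sep: "x = y" if xy: "x \<in> X" "y \<in> X" "d x y = 0" for x y
  proof -
    obtain G where G: "G \<in> C" "x \<in> mspace (M G)" "y \<in> mspace (M G)"
      using ex[of "{x, y}"] xy(1,2) by auto
    then show ?thesis using d[OF G] xy(3) by simp
  qed
  have "\<exists>Y. mspace Y = X \<and> (\<forall>x\<in>X. \<forall>y\<in>X. mdist Y x y = d x y) \<and> age_in F Y"
    by (rule metric_of_age; fact emb sep)
  then obtain Y where Y: "mspace Y = X" "\<forall>x\<in>X. \<forall>y\<in>X. mdist Y x y = d x y" "age_in F Y"
    by blast
  have mem: "((x, y), r) \<in> \<Union>C \<longleftrightarrow> ((x, y), r) \<in> distance_graph Y" for x y r
  proof
    assume "((x, y), r) \<in> \<Union>C"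
    then obtain G where G: "G \<in> C" "((x, y), r) \<in> G" by blast
    then have G': "x \<in> mspace (M G)" "y \<in> mspace (M G)" "r = mdist (M G) x y"
      using inG by blast+
    then have "x \<in> X" "y \<in> X" using G(1) by (auto simp: X_def)
    then show "((x, y), r) \<in> distance_graph Y"
      using Y(1,2) d[OF G(1) G'(1,2)] G'(3) by simp
  next
    assume "((x, y), r) \<in> distance_graph Y"
    then have xy: "x \<in> X" "y \<in> X" "r = d x y" using Y(1,2) by auto
    then obtain G where G: "G \<in> C" "x \<in> mspace (M G)" "y \<in> mspace (M G)"
      using ex[of "{x, y}"] by auto
    then show "((x, y), r) \<in> \<Union>C"
      using d[OF G] xy(3) inG[OF G(1)] by blast
  qed
  have "\<Union>C = distance_graph Y"
  proof (rule set_eqI)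
    show "z \<in> \<Union>C \<longleftrightarrow> z \<in> distance_graph Y" for z
      using mem[of "fst (fst z)" "snd (fst z)" "snd z"] by (simp only: prod.collapse)
  qed
  then show ?thesis using Y(3) by blast
qed

text \<open>
  A maximal \<open>F\<close>-space is saturated. The universe \<open>nat set set\<close> has more elements than any \<open>F\<close>-space,
  so there is always a fresh point that could realize a missing type.
\<close>
lemma saturated_exists:
  assumes sk: "metric_skeletoid F" and sb: "size_bounded F" and "F \<noteq> {}"
  shows "\<exists>X :: nat set set metric. saturated F X"
proof -
  let ?\<G> = "{distance_graph X |X :: nat set set metric. age_in F X}"
  obtain m where "m \<in> F" using \<open>F \<noteq> {}\<close> by blast
  then have "embeddable F A (\<lambda>_ _. 0)" if "A \<subseteq> {}" for A :: "nat set set set"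
    by (rule embeddableI) (use that in simp_all)
  then have "\<exists>E :: nat set set metric. mspace E = {} \<and> (\<forall>x\<in>{}. \<forall>y\<in>{}. mdist E x y = 0) \<and> age_in F E"
    by (intro metric_of_age) auto
  then have "?\<G> \<noteq> {}" by blast
  then have "\<exists>G\<in>?\<G>. \<forall>G'\<in>?\<G>. G \<subseteq> G' \<longrightarrow> G' = G"
    by (rule subset_Zorn_nonempty) (rule distance_graph_chain_Union)
  then obtain X :: "nat set set metric" where age: "age_in F X"
    and max: "\<And>Y. age_in F Y \<Longrightarrow> distance_graph X \<subseteq> distance_graph Y \<Longrightarrow> distance_graph Y = distance_graph X"
    by blast
  have realized: "\<exists>x\<in>mspace X. \<forall>y\<in>mspace X. mdist X x y = h y"
    if h: "\<And>A. finite A \<Longrightarrow> A \<subseteq> mspace X \<Longrightarrow> point_type F A (mdist X) h" for h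
  proof (rule ccontr)
    assume none: "\<not> ?thesis"
    \<comment> \<open>A type that vanishes at \<open>y\<close> is the type of \<open>y\<close>.\<close>
    have h0: "h y \<noteq> 0" if y: "y \<in> mspace X" for y
    proof
      assume "h y = 0"
      have "mdist X y z = h z" if z: "z \<in> mspace X" for z
      proof -
        have "point_type F {y, z} (mdist X) h" using h y z by simp
        then obtain m f p where m: "m \<in> F" "f \<in> {y, z} \<rightarrow> mspace m" "p \<in> mspace m"
          "\<And>a b. a \<in> {y, z} \<Longrightarrow> b \<in> {y, z} \<Longrightarrow> mdist m (f a) (f b) = mdist X a b"
          "\<And>a. a \<in> {y, z} \<Longrightarrow> mdist m p (f a) = h a"
          by (elim point_typeE) (rule that)
        then have "mdist m p (f y) = 0" "f y \<in> mspace m" using \<open>h y = 0\<close> by auto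
        then have "p = f y" using m(3) by simp
        then show ?thesis using m(4)[of y z] m(5)[of z] by simp
      qed
      then show False using none y by blast
    qed
    have "\<not> (UNIV :: nat set set set) \<lesssim> mspace X"
    proof
      assume "(UNIV :: nat set set set) \<lesssim> mspace X"
      then have "(UNIV :: nat set set set) \<lesssim> (UNIV :: nat set set)"
        using age_in_lepoll[OF sk sb age] by (rule lepoll_trans)
      then have "(UNIV :: nat set set set) \<approx> (UNIV :: nat set set)"
        using lepoll_Pow_self[of "UNIV :: nat set set"] by (simp add: lepoll_antisym)
      then show False
        using lesspoll_Pow_self[of "UNIV :: nat set set"] by (simp add: lesspoll_def eqpoll_sym)
    qed
    then have "mspace X \<noteq> UNIV" by (auto simp: lepoll_refl)
    then obtain u where u: "u \<notin> mspace X" by blast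
    let ?g = "\<lambda>v. if v = u then None else Some v"
    let ?d = "\<lambda>v w. adjoin (mdist X) h (?g v) (?g w)"
    have emb: "embeddable F A ?d" if A: "finite A" "A \<subseteq> insert u (mspace X)" for A
    proof (rule embeddable_pullback)
      have "point_type F (A - {u}) (mdist X) h" using h A by auto
      then show "embeddable F (insert None (Some ` (A - {u}))) (adjoin (mdist X) h)"
        by (simp add: point_type_iff_embeddable)
    qed auto
    have sep: "v = w" if "v \<in> insert u (mspace X)" "w \<in> insert u (mspace X)" "?d v w = 0" for v w
      using that h0 u by (auto simp: adjoin_def split: if_splits)
    have "\<exists>Y. mspace Y = insert u (mspace X) \<and>
        (\<forall>v\<in>insert u (mspace X). \<forall>w\<in>insert u (mspace X). mdist Y v w = ?d v w) \<and> age_in F Y"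
      by (rule metric_of_age; fact emb sep)
    then obtain Y where Y: "mspace Y = insert u (mspace X)"
      "\<forall>v\<in>insert u (mspace X). \<forall>w\<in>insert u (mspace X). mdist Y v w = ?d v w" "age_in F Y"
      by blast
    have "mdist Y v w = mdist X v w" if "v \<in> mspace X" "w \<in> mspace X" for v w
      using Y(2) that u by (auto simp: adjoin_def)
    then have "distance_graph X \<subseteq> distance_graph Y"
      unfolding subset_iff split_paired_All using Y(1) by simp
    then have "distance_graph Y = distance_graph X" using max Y(3) by blast
    then have "((u, u), mdist Y u u) \<in> distance_graph X" using Y(1) in_distance_graph[of u u _ Y] by auto
    then show False using u by simp
  qed
  have "saturated F X" by (rule saturatedI[OF age]) (rule realized)
  then show ?thesis by blast
qed

lemma saturated_transfer:
  fixes X :: "'b metric" and \<phi> :: "'b \<Rightarrow> 'c"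
  assumes sat: "saturated F X" and \<phi>: "inj_on \<phi> (mspace X)"
  shows "\<exists>Y :: 'c metric. saturated F Y"
proof -
  define \<psi> where "\<psi> = inv_into (mspace X) \<phi>"
  have \<psi>: "\<psi> (\<phi> x) = x" if "x \<in> mspace X" for x
    using \<phi> that by (simp add: \<psi>_def)
  have emb: "embeddable F A (\<lambda>a b. mdist X (\<psi> a) (\<psi> b))" if "finite A" "A \<subseteq> \<phi> ` mspace X" for A
    by (rule embeddable_pullback[OF age_inD[OF saturated_imp_age_in[OF sat], of "\<psi> ` A"], where g=\<psi>])
      (use that \<psi> in auto)
  have sep: "a = b" if "a \<in> \<phi> ` mspace X" "b \<in> \<phi> ` mspace X" "mdist X (\<psi> a) (\<psi> b) = 0" for a b
    using that \<psi> by auto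
  have "\<exists>Y. mspace Y = \<phi> ` mspace X \<and>
      (\<forall>a\<in>\<phi> ` mspace X. \<forall>b\<in>\<phi> ` mspace X. mdist Y a b = mdist X (\<psi> a) (\<psi> b)) \<and> age_in F Y"
    by (rule metric_of_age; fact emb sep)
  then obtain Y where Y: "mspace Y = \<phi> ` mspace X"
    "\<forall>a\<in>\<phi> ` mspace X. \<forall>b\<in>\<phi> ` mspace X. mdist Y a b = mdist X (\<psi> a) (\<psi> b)" "age_in F Y"
    by blast
  have realized: "\<exists>a\<in>mspace Y. \<forall>b\<in>mspace Y. mdist Y a b = h b"
    if h: "\<And>A. finite A \<Longrightarrow> A \<subseteq> mspace Y \<Longrightarrow> point_type F A (mdist Y) h" for h
  proof -
    have "point_type F A (mdist X) (h \<circ> \<phi>)" if A: "finite A" "A \<subseteq> mspace X" for A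
      by (rule point_type_pullback[OF h[of "\<phi> ` A"], where g=\<phi>]) (use A Y \<psi> in \<open>auto simp: subset_iff\<close>)
    then obtain x where "x \<in> mspace X" "\<forall>y\<in>mspace X. mdist X x y = (h \<circ> \<phi>) y"
      using saturatedD[OF sat] by blast
    then show ?thesis
      using Y(1,2) \<psi> by (intro bexI[of _ "\<phi> x"]) auto
  qed
  have "saturated F Y" by (rule saturatedI[OF Y(3)]) (rule realized)
  then show ?thesis by blast
qed

section \<open>Homogeneity, skeleton and completeness of saturated spaces\<close>

text \<open>
  A relation instead of a function with a domain: the notion is then symmetric under converse, so
  that surjectivity of a maximal partial isometry follows from its totality.
\<close>
definition partial_isometry :: "'b metric \<Rightarrow> ('b \<times> 'b) set \<Rightarrow> bool" where
  "partial_isometry X R \<longleftrightarrow> R \<subseteq> mspace X \<times> mspace X \<and>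
     (\<forall>a\<in>R. \<forall>b\<in>R. mdist X (fst a) (fst b) = mdist X (snd a) (snd b))"

lemma partial_isometry_converse: "partial_isometry X R \<Longrightarrow> partial_isometry X (R\<inverse>)"
  unfolding partial_isometry_def by fastforce

lemma partial_isometryD:
  assumes "partial_isometry X R" "(x, y) \<in> R" "(x', y') \<in> R"
  shows "x \<in> mspace X" "y \<in> mspace X" "mdist X x x' = mdist X y y'"
  using assms unfolding partial_isometry_def by fastforce+

lemma partial_isometry_single_valued:
  assumes "partial_isometry X R" "(x, y) \<in> R" "(x, y') \<in> R"
  shows "y = y'"
proof -
  have "mdist X y y' = mdist X x x" using partial_isometryD(3)[OF assms] by simp
  also have "\<dots> = 0" using partial_isometryD(1)[OF assms] by simp
  finally show ?thesis
    using partial_isometryD(2)[OF assms(1,2,3)] partial_isometryD(2)[OF assms(1,3,2)] by simp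
qed

text \<open>
  The type of \<open>x\<close> over the domain of \<open>R\<close>, transported along \<open>R\<close>, is a point type over the range; a point
  \<open>y\<close> that realizes it is an image for \<open>x\<close>.
\<close>
lemma partial_isometry_extend:
  assumes sk: "metric_skeletoid F" and lc: "layer_closed F" and sat: "saturated F X"
    and R: "partial_isometry X R" "R \<noteq> {}" and x: "x \<in> mspace X"
  obtains y where "partial_isometry X (insert (x, y) R)"
proof -
  define \<rho> where "\<rho> s = (SOME t. (t, s) \<in> R)" for s
  have \<rho>: "(\<rho> s, s) \<in> R" if "s \<in> snd ` R" for s
    using that unfolding \<rho>_def by (force intro: someI)
  have S: "snd ` R \<subseteq> mspace X" "snd ` R \<noteq> {}"
    using R by (auto simp: partial_isometry_def)
  have "point_type F A (mdist X) (\<lambda>s. mdist X x (\<rho> s))" if A: "finite A" "A \<subseteq> snd ` R" for A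
  proof -
    have \<rho>A: "\<rho> s \<in> mspace X" "(\<rho> s, s) \<in> R" if "s \<in> A" for s
      using \<rho>[of s] A(2) that partial_isometryD(1)[OF R(1)] by blast+
    then have "embeddable F (insert x (\<rho> ` A)) (mdist X)"
      using A(1) x by (intro age_inD[OF saturated_imp_age_in[OF sat]]) auto
    then obtain m f where m: "m \<in> F" "f \<in> insert x (\<rho> ` A) \<rightarrow> mspace m"
      "\<forall>a\<in>insert x (\<rho> ` A). \<forall>b\<in>insert x (\<rho> ` A). mdist m (f a) (f b) = mdist X a b"
      unfolding embeddable_def by blast
    show ?thesis
    proof (rule point_typeI[OF m(1), where f="f \<circ> \<rho>" and p="f x"])
      show "mdist m ((f \<circ> \<rho>) s) ((f \<circ> \<rho>) t) = mdist X s t" if "s \<in> A" "t \<in> A" for s t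
        using m(3) that partial_isometryD(3)[OF R(1) \<rho>A(2) \<rho>A(2), OF that] by simp
    qed (use m(2,3) in auto)
  qed
  then obtain y where y: "y \<in> mspace X" "\<And>s. s \<in> snd ` R \<Longrightarrow> mdist X y s = mdist X x (\<rho> s)"
    using realize_point_type[OF sk lc sat S] by blast
  have new: "mdist X x t = mdist X y s" if ts: "(t, s) \<in> R" for t s
  proof -
    have "s \<in> snd ` R" using ts by force
    moreover from \<rho>[OF this] have "\<rho> s = t"
      using partial_isometry_single_valued[OF partial_isometry_converse[OF R(1)]] ts by blast
    ultimately show ?thesis using y(2) by simp
  qed
  have "partial_isometry X (insert (x, y) R)"
    unfolding partial_isometry_def
  proof (intro conjI ballI)
    show "insert (x, y) R \<subseteq> mspace X \<times> mspace X"
      using x y(1) R(1) by (auto simp: partial_isometry_def)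
    fix a b assume "a \<in> insert (x, y) R" "b \<in> insert (x, y) R"
    then consider "a = (x, y)" "b = (x, y)" | "a = (x, y)" "b \<in> R" | "a \<in> R" "b = (x, y)" | "a \<in> R" "b \<in> R"
      by blast
    then show "mdist X (fst a) (fst b) = mdist X (snd a) (snd b)"
    proof cases
      case 1
      have "mdist X x x = 0" "mdist X y y = 0" using x y(1) by simp_all
      then show ?thesis using 1 by simp
    next
      case 2
      then show ?thesis using new[of "fst b" "snd b"] by simp
    next
      case 3
      then show ?thesis using new[of "fst a" "snd a"] by (simp add: mdist_commute)
    next
      case 4
      then show ?thesis using R(1) by (simp add: partial_isometry_def)
    qed
  qed
  then show thesis by (rule that)
qed

text \<open>
  A maximal partial isometry that contains the given one can be extended neither on the left nor
  on the right, so it is an isometry of \<open>X\<close> onto itself. Extension needs a nonempty relation; the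
  empty map is extended by the identity.
\<close>
lemma saturated_absolutely_homogeneous:
  assumes sk: "metric_skeletoid F" and lc: "layer_closed F" and sat: "saturated F X"
  shows "absolutely_homogeneous X"
  unfolding absolutely_homogeneous_def
proof (intro allI impI)
  fix S f assume "S \<subseteq> mspace X \<and> isometric_map X X S f"
  then have S: "S \<subseteq> mspace X" and f: "f \<in> S \<rightarrow> mspace X" "\<forall>x\<in>S. \<forall>y\<in>S. mdist X (f x) (f y) = mdist X x y"
    by (auto simp: isometric_map_def)
  show "\<exists>g. isometry_onto X X g \<and> (\<forall>x\<in>S. g x = f x)"
  proof (cases "S = {}")
    case True
    then show ?thesis
      by (intro exI[of _ "\<lambda>x. x"]) (auto simp: isometry_onto_def isometric_map_def)
  next
    case False
    define G where "G = (\<lambda>x. (x, f x)) ` S"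
    define \<R> where "\<R> = {R. G \<subseteq> R \<and> partial_isometry X R}"
    have G: "G \<in> \<R>"
      using S f by (auto simp: \<R>_def G_def partial_isometry_def)
    have "\<exists>R\<in>\<R>. \<forall>R'\<in>\<R>. R \<subseteq> R' \<longrightarrow> R' = R"
    proof (rule subset_Zorn_nonempty)
      show "\<R> \<noteq> {}" using G by blast
      fix C assume C: "C \<noteq> {}" "subset.chain \<R> C"
      have sub: "G \<subseteq> R" "partial_isometry X R" if "R \<in> C" for R
        using C(2) that by (auto simp: subset_chain_def \<R>_def)
      have "mdist X (fst a) (fst b) = mdist X (snd a) (snd b)" if ab: "a \<in> \<Union>C" "b \<in> \<Union>C" for a b
      proof -
        have "finite {a, b}" "{a, b} \<subseteq> \<Union>C" using ab by auto
        then obtain R where "R \<in> C" "{a, b} \<subseteq> R"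
          using C by (rule finite_subset_Union_chain)
        then show ?thesis using sub(2) unfolding partial_isometry_def by blast
      qed
      moreover have "\<Union>C \<subseteq> mspace X \<times> mspace X"
        using sub(2) unfolding partial_isometry_def by blast
      ultimately have "partial_isometry X (\<Union>C)" by (simp add: partial_isometry_def)
      moreover have "G \<subseteq> \<Union>C" using C(1) sub(1) by blast
      ultimately show "\<Union>C \<in> \<R>" by (simp add: \<R>_def)
    qed
    then obtain R where "R \<in> \<R>" and max: "\<forall>R'\<in>\<R>. R \<subseteq> R' \<longrightarrow> R' = R" by blast
    then have R: "G \<subseteq> R" "partial_isometry X R" by (simp_all add: \<R>_def)
    have ne: "R \<noteq> {}" using R(1) False by (auto simp: G_def)
    have mem: "a \<in> R" if a: "partial_isometry X (insert a R)" for a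
    proof -
      have "insert a R \<in> \<R>" using subset_insertI2[OF R(1)] a by (simp add: \<R>_def)
      then have "insert a R = R" using max by (simp add: subset_insertI)
      then show ?thesis by blast
    qed
    have dom: "\<exists>y. (x, y) \<in> R" if x: "x \<in> mspace X" for x
    proof -
      obtain y where "partial_isometry X (insert (x, y) R)"
        by (rule partial_isometry_extend[OF sk lc sat R(2) ne x])
      then have "(x, y) \<in> R" by (rule mem)
      then show ?thesis ..
    qed
    have ran: "\<exists>x. (x, y) \<in> R" if y: "y \<in> mspace X" for y
    proof -
      have "R\<inverse> \<noteq> {}" using ne by (metis converse_converse converse_empty)
      obtain x where "partial_isometry X (insert (y, x) (R\<inverse>))"
        by (rule partial_isometry_extend[OF sk lc sat partial_isometry_converse[OF R(2)] \<open>R\<inverse> \<noteq> {}\<close> y])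
      moreover have "(insert (y, x) (R\<inverse>))\<inverse> = insert (x, y) R" by auto
      ultimately have "partial_isometry X (insert (x, y) R)"
        using partial_isometry_converse by metis
      then have "(x, y) \<in> R" by (rule mem)
      then show ?thesis ..
    qed
    define g where "g x = (SOME y. (x, y) \<in> R)" for x
    have gR: "(x, g x) \<in> R" if "x \<in> mspace X" for x
      unfolding g_def using someI_ex[OF dom[OF that]] .
    have g_eq: "g x = y" if "(x, y) \<in> R" for x y
      using partial_isometry_single_valued[OF R(2) gR that] partial_isometryD(1)[OF R(2) that that] by blast
    have "isometric_map X X (mspace X) g"
      unfolding isometric_map_def
    proof (intro conjI ballI)
      show "g \<in> mspace X \<rightarrow> mspace X"
        using partial_isometryD(2)[OF R(2) gR gR] by blast
      show "mdist X (g x) (g y) = mdist X x y" if "x \<in> mspace X" "y \<in> mspace X" for x y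
        using partial_isometryD(3)[OF R(2) gR gR] that by simp
    qed
    moreover have "g ` mspace X = mspace X"
    proof (intro equalityI subsetI)
      show "y \<in> mspace X" if "y \<in> g ` mspace X" for y
        using that partial_isometryD(2)[OF R(2) gR gR] by blast
      fix y assume "y \<in> mspace X"
      then obtain x where xy: "(x, y) \<in> R" using ran by blast
      then show "y \<in> g ` mspace X"
        using g_eq[OF xy] partial_isometryD(1)[OF R(2) xy xy] by blast
    qed
    moreover have "g x = f x" if "x \<in> S" for x
      using g_eq[of x "f x"] R(1) that by (auto simp: G_def)
    ultimately show ?thesis by (auto simp: isometry_onto_def)
  qed
qed

lemma skeletonI:
  assumes "finite (mspace m)" "mspace m \<noteq> {}" "isometric_map m X (mspace m) \<phi>"
  shows "m \<in> skeleton X"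
proof -
  have "\<phi> ` mspace m \<subseteq> mspace X" using assms(3) by (auto simp: isometric_map_def)
  moreover from this have "isometry_onto m (submetric X (\<phi> ` mspace m)) \<phi>"
    using assms(3) by (auto simp: isometry_onto_def isometric_map_def)
  ultimately show ?thesis
    using assms(1,2) unfolding skeleton_def isometric_def by blast
qed

lemma skeletonE:
  assumes "m \<in> skeleton X"
  obtains \<phi> where "finite (mspace m)" "mspace m \<noteq> {}" "isometric_map m X (mspace m) \<phi>"
proof -
  obtain S \<phi> where "S \<subseteq> mspace X" "isometry_onto m (submetric X S) \<phi>"
    using assms unfolding skeleton_def isometric_def by blast
  then have "isometric_map m X (mspace m) \<phi>"
    by (auto simp: isometry_onto_def isometric_map_def)
  then show thesis using assms that by (auto simp: skeleton_def)
qed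

lemma isometric_mapD:
  assumes "isometric_map m X S \<phi>"
  shows "x \<in> S \<Longrightarrow> \<phi> x \<in> mspace X" "x \<in> S \<Longrightarrow> y \<in> S \<Longrightarrow> mdist X (\<phi> x) (\<phi> y) = mdist m x y"
  using assms by (auto simp: isometric_map_def)

lemma isometric_map_inj_on:
  assumes "isometric_map m X S \<phi>" "S \<subseteq> mspace m"
  shows "inj_on \<phi> S"
proof (rule inj_onI)
  fix x y assume xy: "x \<in> S" "y \<in> S" "\<phi> x = \<phi> y"
  have "mdist m x y = mdist X (\<phi> x) (\<phi> y)" using isometric_mapD(2)[OF assms(1) xy(1,2)] by simp
  also have "\<dots> = 0" using isometric_mapD(1)[OF assms(1)] xy by simp
  finally show "x = y" using xy assms(2) by (simp add: subset_iff)
qed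

lemma skeleton_subset_age:
  assumes sk: "metric_skeletoid F" and age: "age_in F X"
  shows "skeleton X \<subseteq> F"
proof
  fix m assume "m \<in> skeleton X"
  then obtain \<phi> where m: "finite (mspace m)" "mspace m \<noteq> {}" and \<phi>: "isometric_map m X (mspace m) \<phi>"
    by (rule skeletonE)
  have "embeddable F (\<phi> ` mspace m) (mdist X)"
    using m(1) isometric_mapD(1)[OF \<phi>] by (intro age_inD[OF age]) auto
  then obtain m' f where m': "m' \<in> F" "f \<in> \<phi> ` mspace m \<rightarrow> mspace m'"
    "\<forall>a\<in>\<phi> ` mspace m. \<forall>b\<in>\<phi> ` mspace m. mdist m' (f a) (f b) = mdist X a b"
    unfolding embeddable_def by blast
  then have iso: "isometric_map m m' (mspace m) (f \<circ> \<phi>)"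
    using isometric_mapD(2)[OF \<phi>] by (auto simp: isometric_map_def)
  have "space_in F (mspace m) (mdist m)"
    by (rule space_inI[OF sk m'(1) m(2), of "f \<circ> \<phi>"])
      (use iso isometric_map_inj_on[OF iso] in \<open>auto simp: isometric_map_def\<close>)
  then obtain m'' where m'': "m'' \<in> F" "mspace m'' = mspace m"
    "\<forall>x\<in>mspace m. \<forall>y\<in>mspace m. mdist m'' x y = mdist m x y"
    unfolding space_in_def by blast
  then have "isometric m'' m"
    unfolding isometric_def isometry_onto_def isometric_map_def
    by (intro exI[of _ "\<lambda>x. x"]) auto
  then show "m \<in> F" using skeletoid_closed(4)[OF sk m''(1)] by blast
qed

text \<open>
  A member of \<open>F\<close> is embedded point by point: the distances of the next point to the points already
  embedded are a point type over their images.
\<close>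
lemma saturated_skeleton:
  assumes sk: "metric_skeletoid F" and lc: "layer_closed F" and sat: "saturated F X"
  shows "skeleton X = F"
proof
  show "skeleton X \<subseteq> F"
    by (rule skeleton_subset_age[OF sk saturated_imp_age_in[OF sat]])
  show "F \<subseteq> skeleton X"
  proof
    fix m assume m: "m \<in> F"
    have "\<exists>f. isometric_map m X B f" if "finite B" "B \<subseteq> mspace m" for B
      using that
    proof (induction B rule: finite_induct)
      case empty
      then show ?case by (simp add: isometric_map_def)
    next
      case (insert b B)
      then obtain f where f: "isometric_map m X B f" by auto
      have bB: "b \<in> mspace m" "B \<subseteq> mspace m" using insert.prems by auto
      have "\<exists>y\<in>mspace X. \<forall>c\<in>B. mdist X y (f c) = mdist m b c"
      proof (cases "B = {}")
        case True
        \<comment> \<open>In the empty space every function is a point type, but none is realized.\<close>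
        obtain p where "p \<in> mspace m" using bB(1) by blast
        then have "point_type F A (mdist X) (\<lambda>_. 0)" if "A \<subseteq> mspace X" "mspace X = {}" for A
          using that m by (intro point_typeI[of m]) auto
        then have "mspace X \<noteq> {}" using saturatedD[OF sat, of "\<lambda>_. 0"] by blast
        then show ?thesis using True by blast
      next
        case False
        have inj: "inj_on f B" by (rule isometric_map_inj_on[OF f bB(2)])
        define g where "g = inv_into B f"
        have g: "g (f c) = c" if "c \<in> B" for c using inj that by (simp add: g_def)
        have S: "f ` B \<subseteq> mspace X" "f ` B \<noteq> {}" using isometric_mapD(1)[OF f] False by auto
        have "point_type F A (mdist X) (\<lambda>s. mdist m b (g s))" if A: "A \<subseteq> f ` B" for A
        proof (rule point_typeI[OF m, where f=g and p=b])
          have "g ` f ` B \<subseteq> mspace m" using g bB(2) by auto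
          then show "g \<in> A \<rightarrow> mspace m" using A by blast
          show "mdist m (g s) (g t) = mdist X s t" if st: "s \<in> A" "t \<in> A" for s t
          proof -
            obtain c d where "c \<in> B" "s = f c" "d \<in> B" "t = f d" using st A by blast
            then show ?thesis using g isometric_mapD(2)[OF f] by simp
          qed
        qed (use bB in auto)
        then obtain y where "y \<in> mspace X" "\<And>s. s \<in> f ` B \<Longrightarrow> mdist X y s = mdist m b (g s)"
          using realize_point_type[OF sk lc sat S] by blast
        then show ?thesis using g by (intro bexI[of _ y]) auto
      qed
      then obtain y where y: "y \<in> mspace X" "\<And>c. c \<in> B \<Longrightarrow> mdist X y (f c) = mdist m b c" by blast
      have "isometric_map m X (insert b B) (f(b := y))"
        unfolding isometric_map_def
      proof (intro conjI ballI)
        show "f(b := y) \<in> insert b B \<rightarrow> mspace X"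
          using y(1) isometric_mapD(1)[OF f] by auto
        fix c d assume cd: "c \<in> insert b B" "d \<in> insert b B"
        have "mdist X y y = 0" "mdist m b b = 0" using y(1) bB(1) by simp_all
        moreover have "mdist X (f c) y = mdist m c b" if "c \<in> B" for c
          using y(2)[OF that] by (metis mdist_commute)
        ultimately show "mdist X ((f(b := y)) c) ((f(b := y)) d) = mdist m c d"
          using cd y(2) isometric_mapD(2)[OF f] by auto
      qed
      then show ?case by blast
    qed
    then obtain f where "isometric_map m X (mspace m) f"
      using skeletoid_closed(1)[OF sk m] by blast
    then show "m \<in> skeleton X"
      using skeletoid_closed(1,2)[OF sk m] by (intro skeletonI)
  qed
qed

text \<open>
  The distances from the terms of a Cauchy sequence converge, and their limit \<open>h\<close> is a point type
  because it is a limit of types of points. A point \<open>x\<close> of type \<open>h\<close> is the limit: its distance to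
  \<open>\<sigma> n\<close> is the limit of the distances from \<open>\<sigma> k\<close> to \<open>\<sigma> n\<close> as \<open>k\<close> grows, which is small for large \<open>n\<close>.
\<close>
lemma saturated_complete:
  assumes sk: "metric_skeletoid F" and lc: "layer_closed F" and sat: "saturated F X"
  shows "mcomplete_of X"
proof -
  interpret Metric_space "mspace X" "mdist X" by (rule Metric_space_mspace_mdist)
  have "\<exists>x. limitin mtopology \<sigma> x sequentially" if \<sigma>: "MCauchy \<sigma>" for \<sigma>
  proof -
    have \<sigma>X: "\<sigma> n \<in> mspace X" for n using \<sigma> by (auto simp: MCauchy_def)
    have \<sigma>C: "\<exists>N. \<forall>k\<ge>N. \<forall>n\<ge>N. mdist X (\<sigma> k) (\<sigma> n) < \<epsilon>" if "\<epsilon> > 0" for \<epsilon>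
    proof -
      have "\<exists>N. \<forall>k n. N \<le> k \<longrightarrow> N \<le> n \<longrightarrow> mdist X (\<sigma> k) (\<sigma> n) < \<epsilon>"
        using \<sigma> that by (simp add: MCauchy_def)
      then show ?thesis by blast
    qed
    have "\<exists>l. (\<lambda>n. mdist X (\<sigma> n) y) \<longlonglongrightarrow> l" if y: "y \<in> mspace X" for y
    proof -
      have "Cauchy (\<lambda>n. mdist X (\<sigma> n) y)"
        unfolding Cauchy_def
      proof (intro allI impI)
        fix \<epsilon> :: real assume "\<epsilon> > 0"
        then obtain N where N: "\<forall>k\<ge>N. \<forall>n\<ge>N. mdist X (\<sigma> k) (\<sigma> n) < \<epsilon>" using \<sigma>C by blast
        have "dist (mdist X (\<sigma> k) y) (mdist X (\<sigma> n) y) < \<epsilon>" if "k \<ge> N" "n \<ge> N" for k n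
        proof -
          have "mdist X (\<sigma> k) (\<sigma> n) < \<epsilon>" using N that by blast
          then show ?thesis
            using mdist_triangle[OF \<sigma>X \<sigma>X y, of k n] mdist_triangle[OF \<sigma>X \<sigma>X y, of n k]
              mdist_commute[of X "\<sigma> n" "\<sigma> k"] unfolding dist_real_def by linarith
        qed
        then show "\<exists>M. \<forall>m\<ge>M. \<forall>n\<ge>M. dist (mdist X (\<sigma> m) y) (mdist X (\<sigma> n) y) < \<epsilon>" by blast
      qed
      then show ?thesis using Cauchy_convergent_iff convergent_def by blast
    qed
    then obtain h where h: "\<And>y. y \<in> mspace X \<Longrightarrow> (\<lambda>n. mdist X (\<sigma> n) y) \<longlonglongrightarrow> h y" by metis
    have "point_type F A (mdist X) h" if A: "finite A" "A \<subseteq> mspace X" for A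
    proof (rule point_type_limit[OF sk lc A(1)])
      fix \<epsilon> :: real assume \<epsilon>: "\<epsilon> > 0"
      have "\<forall>y\<in>A. eventually (\<lambda>n. \<bar>mdist X (\<sigma> n) y - h y\<bar> < \<epsilon>) sequentially"
        using h A(2) \<epsilon> by (auto simp: tendsto_iff dist_real_def)
      then have "eventually (\<lambda>n. \<forall>y\<in>A. \<bar>mdist X (\<sigma> n) y - h y\<bar> < \<epsilon>) sequentially"
        using A(1) by (simp add: eventually_ball_finite)
      then obtain n where n: "\<forall>y\<in>A. \<bar>mdist X (\<sigma> n) y - h y\<bar> < \<epsilon>"
        using eventually_happens'[OF sequentially_bot] by blast
      have "embeddable F (insert (\<sigma> n) A) (mdist X)"
        using A \<sigma>X by (intro age_inD[OF saturated_imp_age_in[OF sat]]) auto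
      then obtain m f where m: "m \<in> F" "f \<in> insert (\<sigma> n) A \<rightarrow> mspace m"
        "\<forall>a\<in>insert (\<sigma> n) A. \<forall>b\<in>insert (\<sigma> n) A. mdist m (f a) (f b) = mdist X a b"
        unfolding embeddable_def by blast
      have "point_type F A (mdist X) (mdist X (\<sigma> n))"
        by (rule point_typeI[OF m(1), where f=f and p="f (\<sigma> n)"]) (use m(2,3) in auto)
      then show "\<exists>d' h'. point_type F A d' h' \<and> (\<forall>x\<in>A. \<forall>y\<in>A. \<bar>d' x y - mdist X x y\<bar> < \<epsilon>) \<and>
          (\<forall>x\<in>A. \<bar>h' x - h x\<bar> < \<epsilon>)"
        using n \<epsilon> by (intro exI[of _ "mdist X"] exI[of _ "mdist X (\<sigma> n)"]) simp
    qed
    then obtain x where x: "x \<in> mspace X" "\<forall>y\<in>mspace X. mdist X x y = h y"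
      using saturatedD[OF sat] by blast
    have "\<exists>N. \<forall>n\<ge>N. mdist X (\<sigma> n) x < \<epsilon>" if \<epsilon>: "\<epsilon> > 0" for \<epsilon>
    proof -
      obtain N where N: "\<forall>k\<ge>N. \<forall>n\<ge>N. mdist X (\<sigma> k) (\<sigma> n) < \<epsilon> / 2"
        using \<sigma>C[of "\<epsilon> / 2"] \<epsilon> by auto
      have "mdist X (\<sigma> n) x < \<epsilon>" if n: "n \<ge> N" for n
      proof -
        have "h (\<sigma> n) \<le> \<epsilon> / 2"
          by (rule LIMSEQ_le_const2[OF h[OF \<sigma>X]]) (use N n in \<open>auto intro: less_imp_le\<close>)
        then show ?thesis using x(2) \<sigma>X \<epsilon> mdist_commute[of X x "\<sigma> n"] by simp
      qed
      then show ?thesis by blast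
    qed
    then have "limitin mtopology \<sigma> x sequentially"
      using x(1) \<sigma>X by (auto simp: limitin_metric eventually_sequentially)
    then show ?thesis by blast
  qed
  then show ?thesis by (simp add: mcomplete_of_def mcomplete_def)
qed

lemma saturated_Heine_Borel:
  assumes sk: "metric_skeletoid F" and lc: "layer_closed F" and sb: "size_bounded F"
    and sat: "saturated F X"
  shows "Heine_Borel X"
  unfolding Heine_Borel_def
proof (intro ballI allI)
  interpret Metric_space "mspace X" "mdist X" by (rule Metric_space_mspace_mdist)
  fix x r assume x: "x \<in> mspace X"
  have "mtotally_bounded (mcball x r)"
    unfolding mtotally_bounded_def
  proof (intro allI impI)
    fix \<epsilon> :: real assume \<epsilon>: "\<epsilon> > 0"
    have bound: "mdist X y z \<le> 2 * r" if "y \<in> mcball x r" "z \<in> mcball x r" for y z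
      using that mdist_triangle[of y X x z] by (simp add: mdist_commute[of X x y])
    have sub: "mcball x r \<subseteq> mspace X" by auto
    obtain K where "finite K" "K \<subseteq> mcball x r" "\<And>y. y \<in> mcball x r \<Longrightarrow> \<exists>k\<in>K. mdist X y k < \<epsilon>"
      using age_in_finite_net[OF sk sb saturated_imp_age_in[OF sat] \<epsilon> sub bound] by blast
    moreover from this have "mcball x r \<subseteq> (\<Union>k\<in>K. mball k \<epsilon>)"
      using sub unfolding subset_iff UN_iff in_mball by (metis mdist_commute)
    ultimately show "\<exists>K. finite K \<and> K \<subseteq> mcball x r \<and> mcball x r \<subseteq> (\<Union>k\<in>K. mball k \<epsilon>)"
      by blast
  qed
  moreover have mcomplete
    using saturated_complete[OF sk lc sat] by (simp add: mcomplete_of_def)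
  ultimately have "\<exists>l q. l \<in> mcball x r \<and> strict_mono q \<and> limitin mtopology (\<sigma> \<circ> q) l sequentially"
    if \<sigma>: "range \<sigma> \<subseteq> mcball x r" for \<sigma> :: "nat \<Rightarrow> 'a"
  proof -
    obtain q where q: "strict_mono q" "MCauchy (\<sigma> \<circ> q)"
      using mtotally_bounded_sequentially[THEN iffD1, OF \<open>mtotally_bounded (mcball x r)\<close>] \<sigma> by blast
    then obtain l where l: "limitin mtopology (\<sigma> \<circ> q) l sequentially"
      using \<open>mcomplete\<close> unfolding mcomplete_def by blast
    have "\<forall>n. (\<sigma> \<circ> q) n \<in> mcball x r" using \<sigma> by (simp only: comp_apply) blast
    then have "eventually (\<lambda>n. (\<sigma> \<circ> q) n \<in> mcball x r) sequentially"
      by (rule always_eventually)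
    then have "l \<in> mcball x r"
      by (rule limitin_closedin[OF l closedin_mcball _ trivial_limit_sequentially])
    then show ?thesis using q(1) l by blast
  qed
  then have "compactin mtopology (mcball x r)"
    unfolding compactin_sequentially using mcball_subset_mspace by blast
  then show "compactin (mtopology_of X) (mcball_of X x r)"
    by (simp add: mtopology_of_def mcball_of_def)
qed

section \<open>Skeletons of Heine--Borel spaces\<close>

text \<open>
  A map from one point to another is isometric, so it extends to an isometry of \<open>X\<close>, and this
  isometry moves any given copy of \<open>m\<close> to one through \<open>p\<close>.
\<close>
lemma absolutely_homogeneous_copy_at:
  assumes ah: "absolutely_homogeneous X" and m: "m \<in> skeleton X" and x: "x \<in> mspace m"
    and p: "p \<in> mspace X"
  obtains \<psi> where "isometric_map m X (mspace m) \<psi>" "\<psi> x = p"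
proof -
  obtain \<phi> where \<phi>: "isometric_map m X (mspace m) \<phi>"
    using m by (rule skeletonE)
  have "\<phi> x \<in> mspace X" using isometric_mapD(1)[OF \<phi> x] .
  moreover from this p have "mdist X p p = mdist X (\<phi> x) (\<phi> x)" by (metis mdist_zero)
  ultimately have "isometric_map X X {\<phi> x} (\<lambda>_. p)" "{\<phi> x} \<subseteq> mspace X"
    using p by (simp_all add: isometric_map_def)
  then obtain g where g: "isometry_onto X X g" "\<forall>y\<in>{\<phi> x}. g y = p"
    using ah unfolding absolutely_homogeneous_def by blast
  have g': "isometric_map X X (mspace X) g" using g(1) by (simp add: isometry_onto_def)
  have "isometric_map m X (mspace m) (g \<circ> \<phi>)"
    unfolding isometric_map_def
    using isometric_mapD[OF g'] isometric_mapD[OF \<phi>] by simp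
  then show thesis
    using that[of "g \<circ> \<phi>"] g(2) by simp
qed

lemma (in Metric_space) compactin_common_subsequence:
  fixes x :: "nat \<Rightarrow> 'i \<Rightarrow> 'a"
  assumes C: "compactin mtopology C" and "finite I"
    and x: "\<And>k i. i \<in> I \<Longrightarrow> x k i \<in> C"
  shows "\<exists>q l. strict_mono q \<and> (\<forall>i\<in>I. l i \<in> M \<and> (\<lambda>k. d (x (q k) i) (l i)) \<longlonglongrightarrow> 0)"
  using \<open>finite I\<close> x
proof (induction I rule: finite_induct)
  case empty
  show ?case by (intro exI[of _ id]) (simp add: strict_mono_def)
next
  case (insert j I)
  then obtain q l where q: "strict_mono q"
    and l: "\<forall>i\<in>I. l i \<in> M \<and> (\<lambda>k. d (x (q k) i) (l i)) \<longlonglongrightarrow> 0" by auto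
  have "range (\<lambda>k. x (q k) j) \<subseteq> C" using insert.prems by auto
  then obtain y s where y: "y \<in> C" "strict_mono s" "limitin mtopology ((\<lambda>k. x (q k) j) \<circ> s) y sequentially"
    using C unfolding compactin_sequentially by blast
  have "strict_mono (q \<circ> s)" using q y(2) by (rule strict_mono_o)
  moreover have "y \<in> M" "(\<lambda>k. d (x ((q \<circ> s) k) j) y) \<longlonglongrightarrow> 0"
    using y(3) by (simp_all add: limitin_metric_dist_null comp_def)
  moreover have "(\<lambda>k. d (x ((q \<circ> s) k) i) (l i)) \<longlonglongrightarrow> 0" if "i \<in> I" for i
    using LIMSEQ_subseq_LIMSEQ[OF _ y(2), of "\<lambda>k. d (x (q k) i) (l i)" 0] l that by (simp add: comp_def)
  ultimately show ?case
    using l insert.hyps(2) by (intro exI[of _ "q \<circ> s"] exI[of _ "l(j := y)"]) (auto simp: comp_def)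
qed

text \<open>
  Choose copies \<open>x k\<close> of better and better approximations to \<open>\<delta>\<close>, all with first point \<open>p\<close>. They stay
  in one ball about \<open>p\<close>, which is compact, and the limit of a subsequence is a copy of \<open>\<delta>\<close>.
\<close>
lemma Heine_Borel_skeleton_layer_closed:
  assumes hb: "Heine_Borel X" and ah: "absolutely_homogeneous X"
  shows "layer_closed (skeleton X)"
  unfolding layer_closed_def
proof (intro allI impI)
  interpret Metric_space "mspace X" "mdist X" by (rule Metric_space_mspace_mdist)
  fix n :: nat assume n: "n > 1"
  let ?I = "{1..n}"
  have one: "1 \<in> ?I" using n by simp
  have "\<delta> \<in> metrics_in (skeleton X) ?I"
    if \<delta>: "\<delta> \<in> metrics_in UNIV ?I"
      and approx: "\<forall>\<epsilon>>0. \<exists>\<delta>'\<in>metrics_in (skeleton X) ?I. \<forall>i\<in>?I \<times> ?I. \<bar>\<delta>' i - \<delta> i\<bar> < \<epsilon>" for \<delta>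
  proof -
    \<comment> \<open>The case of a \<open>p\<close> that is not a point of \<open>X\<close> shows that \<open>X\<close> has a point.\<close>
    have copy: "\<exists>\<psi>. (\<forall>i\<in>?I. \<psi> i \<in> mspace X) \<and> (p \<in> mspace X \<longrightarrow> \<psi> 1 = p) \<and>
        (\<forall>i\<in>?I. \<forall>j\<in>?I. \<bar>mdist X (\<psi> i) (\<psi> j) - \<delta> (i, j)\<bar> < 1 / real (Suc k))" for p k
    proof -
      have "1 / real (Suc k) > 0" by simp
      then obtain \<delta>' where \<delta>': "\<delta>' \<in> metrics_in (skeleton X) ?I"
        "\<forall>i\<in>?I \<times> ?I. \<bar>\<delta>' i - \<delta> i\<bar> < 1 / real (Suc k)"
        using approx by meson
      then obtain m where m: "m \<in> skeleton X" "mspace m = ?I"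
        "\<forall>i\<in>?I. \<forall>j\<in>?I. mdist m i j = curry \<delta>' i j"
        unfolding metrics_in_def space_in_def by blast
      obtain \<psi> where "isometric_map m X (mspace m) \<psi>" "p \<in> mspace X \<longrightarrow> \<psi> 1 = p"
      proof (cases "p \<in> mspace X")
        case True
        have "1 \<in> mspace m" using one m(2) by simp
        then obtain \<psi> where "isometric_map m X (mspace m) \<psi>" "\<psi> 1 = p"
          by (rule absolutely_homogeneous_copy_at[OF ah m(1) _ True])
        then show ?thesis using that by blast
      next
        case False
        obtain \<psi> where "isometric_map m X (mspace m) \<psi>" using m(1) by (rule skeletonE)
        then show ?thesis using that False by blast
      qed
      then show ?thesis
        using isometric_mapD[of m X ?I \<psi>] m(2,3) \<delta>'(2)
        by (intro exI[of _ \<psi>]) (simp del: atLeastAtMost_iff)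
    qed
    obtain p where p: "p \<in> mspace X" using copy one by blast
    have "\<forall>k. \<exists>\<psi>. (\<forall>i\<in>?I. \<psi> i \<in> mspace X) \<and> \<psi> 1 = p \<and>
        (\<forall>i\<in>?I. \<forall>j\<in>?I. \<bar>mdist X (\<psi> i) (\<psi> j) - \<delta> (i, j)\<bar> < 1 / real (Suc k))"
      using copy[of p] p by simp
    then obtain x where x: "\<And>k i. i \<in> ?I \<Longrightarrow> x k i \<in> mspace X" "\<And>k. x k 1 = p"
      "\<And>k i j. i \<in> ?I \<Longrightarrow> j \<in> ?I \<Longrightarrow> \<bar>mdist X (x k i) (x k j) - \<delta> (i, j)\<bar> < 1 / real (Suc k)"
      by metis
    \<comment> \<open>The summand 1 bounds all errors \<open>1 / (k + 1)\<close>.\<close>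
    define r where "r = Max ((\<lambda>i. \<delta> (1, i)) ` ?I) + 1"
    have "x k i \<in> mcball p r" if i: "i \<in> ?I" for k i
    proof -
      have "mdist X p (x k i) < \<delta> (1, i) + 1 / real (Suc k)"
        using x(3)[OF one i, of k] x(2)[of k] by simp
      also have "\<dots> \<le> r"
        unfolding r_def using i by (intro add_mono Max_ge) auto
      finally show ?thesis using p x(1)[OF i] by simp
    qed
    moreover have "compactin mtopology (mcball p r)"
      using hb p by (simp add: Heine_Borel_def mtopology_of_def mcball_of_def)
    ultimately obtain q l where q: "strict_mono q"
      and l: "\<forall>i\<in>?I. l i \<in> mspace X \<and> (\<lambda>k. mdist X (x (q k) i) (l i)) \<longlonglongrightarrow> 0"
      using compactin_common_subsequence[of "mcball p r" ?I x] by blast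
    have dist_l: "mdist X (l i) (l j) = \<delta> (i, j)" if ij: "i \<in> ?I" "j \<in> ?I" for i j
    proof -
      let ?err = "\<lambda>k. mdist X (x (q k) i) (l i) + mdist X (x (q k) j) (l j) + 1 / real (Suc k)"
      have "?err \<longlonglongrightarrow> 0 + 0 + 0"
        using l ij LIMSEQ_inverse_real_of_nat by (intro tendsto_add) (auto simp: inverse_eq_divide)
      moreover have "\<bar>mdist X (l i) (l j) - \<delta> (i, j)\<bar> \<le> ?err k" for k
      proof -
        have mem: "x (q k) i \<in> mspace X" "x (q k) j \<in> mspace X" "l i \<in> mspace X" "l j \<in> mspace X"
          using x(1) l ij by auto
        have "1 / real (Suc (q k)) \<le> 1 / real (Suc k)"
          using seq_suble[OF q, of k] by (simp add: field_simps)
        moreover have "mdist X (l i) (l j) \<le> mdist X (l i) (x (q k) i) + mdist X (x (q k) i) (l j)"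
          "mdist X (x (q k) i) (l j) \<le> mdist X (x (q k) i) (x (q k) j) + mdist X (x (q k) j) (l j)"
          "mdist X (x (q k) i) (x (q k) j) \<le> mdist X (x (q k) i) (l i) + mdist X (l i) (x (q k) j)"
          "mdist X (l i) (x (q k) j) \<le> mdist X (l i) (l j) + mdist X (l j) (x (q k) j)"
          using mem by (simp_all only: mdist_triangle)
        moreover have "mdist X (l i) (x (q k) i) = mdist X (x (q k) i) (l i)"
          "mdist X (l j) (x (q k) j) = mdist X (x (q k) j) (l j)"
          by (rule mdist_commute)+
        ultimately show ?thesis using x(3)[OF ij, of "q k"] by linarith
      qed
      ultimately have "\<bar>mdist X (l i) (l j) - \<delta> (i, j)\<bar> \<le> 0 + 0 + 0"
        by (intro LIMSEQ_le_const) auto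
      then show ?thesis by simp
    qed
    obtain m where m: "mspace m = ?I" "\<forall>i\<in>?I. \<forall>j\<in>?I. mdist m i j = \<delta> (i, j)"
      using \<delta> unfolding metrics_in_def space_in_def by auto
    have "m \<in> skeleton X"
    proof (rule skeletonI)
      show "isometric_map m X (mspace m) l"
        using l dist_l m by (simp add: isometric_map_def del: atLeastAtMost_iff)
    qed (use m(1) n in auto)
    then show ?thesis
      using m \<delta> unfolding metrics_in_def space_in_def by auto
  qed
  then show "closedin (subtopology (product_topology (\<lambda>_. euclideanreal) (?I \<times> ?I))
      (metrics_in UNIV ?I)) (metrics_in (skeleton X) ?I)"
    by (subst closedin_pointwise_iff) (auto simp: metrics_in_def space_in_def)
qed

text \<open>
  Cover the ball of radius \<open>N\<close> about \<open>p\<close> by finitely many balls of radius \<open>1 / (2 N)\<close>. A copy through \<open>p\<close>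
  of a member with positive distances in \<open>[1/N, N]\<close> lies in this ball and has at most one point in
  each of the small balls.
\<close>
lemma Heine_Borel_skeleton_size_bounded:
  assumes hb: "Heine_Borel X" and ah: "absolutely_homogeneous X"
  shows "size_bounded (skeleton X)"
proof (cases "mspace X = {}")
  case True
  then have "skeleton X = {}" by (auto simp: skeleton_def isometric_def isometry_onto_def isometric_map_def)
  then show ?thesis unfolding size_bounded_def by auto
next
  case False
  then obtain p where p: "p \<in> mspace X" by blast
  interpret Metric_space "mspace X" "mdist X" by (rule Metric_space_mspace_mdist)
  show ?thesis
    unfolding size_bounded_def
  proof (intro allI impI)
    fix N :: nat assume N: "N > 1"
    have "compactin mtopology (mcball p (real N))"
      using hb p by (simp add: Heine_Borel_def mtopology_of_def mcball_of_def)
    then have tb: "mtotally_bounded (mcball p (real N))" by (rule compactin_imp_mtotally_bounded)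
    have "1 / (2 * real N) > 0" using N by simp
    from tb[unfolded mtotally_bounded_def, rule_format, OF this] obtain K where K: "finite K" "K \<subseteq> mcball p (real N)"
      "mcball p (real N) \<subseteq> (\<Union>k\<in>K. mball k (1 / (2 * real N)))"
      by blast
    have "card (mspace m) \<le> card K + 1"
      if m: "m \<in> skeleton X" and sep: "\<forall>x\<in>mspace m. \<forall>y\<in>mspace m. mdist m x y > 0 \<longrightarrow>
            mdist m x y \<in> {1 / real N..real N}" for m
    proof -
      obtain x where x: "x \<in> mspace m" using m by (auto simp: skeleton_def)
      obtain \<psi> where \<psi>: "isometric_map m X (mspace m) \<psi>" "\<psi> x = p"
        by (rule absolutely_homogeneous_copy_at[OF ah m x p])
      have "\<exists>k\<in>K. mdist X k (\<psi> z) < 1 / (2 * real N)" if z: "z \<in> mspace m" for z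
      proof -
        have "mdist m x z \<le> real N"
          using sep x z by (cases "mdist m x z > 0") auto
        then have "\<psi> z \<in> mcball p (real N)"
          using isometric_mapD(1)[OF \<psi>(1) z] isometric_mapD(2)[OF \<psi>(1) x z] \<psi>(2) p by simp
        then have "\<psi> z \<in> (\<Union>k\<in>K. mball k (1 / (2 * real N)))" using K(3) by blast
        then show ?thesis by auto
      qed
      then obtain c where c: "\<And>z. z \<in> mspace m \<Longrightarrow> c z \<in> K"
        "\<And>z. z \<in> mspace m \<Longrightarrow> mdist X (c z) (\<psi> z) < 1 / (2 * real N)"
        by metis
      have "inj_on c (mspace m)"
      proof (rule inj_onI, rule ccontr)
        fix z w assume zw: "z \<in> mspace m" "w \<in> mspace m" "c z = c w" "z \<noteq> w"
        have "mdist m z w \<noteq> 0" using zw(1,2,4) by simp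
        then have "mdist m z w > 0" using mdist_nonneg[of m z w] by linarith
        then have "1 / real N \<le> mdist X (\<psi> z) (\<psi> w)"
          using sep zw(1,2) isometric_mapD(2)[OF \<psi>(1) zw(1,2)] by simp
        also have "\<dots> \<le> mdist X (\<psi> z) (c z) + mdist X (c z) (\<psi> w)"
          using K(2) c(1)[OF zw(1)] isometric_mapD(1)[OF \<psi>(1)] zw(1,2)
          by (intro mdist_triangle) auto
        also have "\<dots> < 1 / (2 * real N) + 1 / (2 * real N)"
          using c(2)[OF zw(1)] c(2)[OF zw(2)] zw(3) mdist_commute[of X "\<psi> z" "c z"] by simp
        also have "\<dots> = 1 / real N" using N by (simp add: field_simps)
        finally show False by simp
      qed
      moreover have "c ` mspace m \<subseteq> K" using c(1) by blast
      ultimately show ?thesis using card_inj_on_le[OF _ _ K(1)] by fastforce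
    qed
    then show "\<exists>\<mu>>0. \<forall>m\<in>skeleton X. (\<forall>x\<in>mspace m. \<forall>y\<in>mspace m. 0 < mdist m x y \<longrightarrow>
        mdist m x y \<in> {1 / real N..real N}) \<longrightarrow> card (mspace m) \<le> \<mu>"
      by (intro exI[of _ "card K + 1"]) auto
  qed
qed

section \<open>Compactness and diameters\<close>

lemma compact_metric_imp_Heine_Borel:
  assumes "compact_metric X"
  shows "Heine_Borel X"
proof -
  interpret Metric_space "mspace X" "mdist X" by (rule Metric_space_mspace_mdist)
  have "compact_space mtopology"
    using assms by (simp add: compact_metric_def mtopology_of_def)
  then show ?thesis
    unfolding Heine_Borel_def mtopology_of_def mcball_of_def
    using closedin_compact_space closedin_mcball by blast
qed

lemma compact_metric_bounded_diameters:
  assumes "compact_metric X"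
  shows "\<exists>B. \<forall>m\<in>skeleton X. mdiameter m \<le> B"
proof -
  interpret Metric_space "mspace X" "mdist X" by (rule Metric_space_mspace_mdist)
  have "compactin mtopology (mspace X)"
    using assms by (simp add: compact_metric_def mtopology_of_def compact_space_def)
  then have "mbounded (mspace X)" by (rule compactin_imp_mbounded)
  then obtain B where B: "\<forall>x\<in>mspace X. \<forall>y\<in>mspace X. mdist X x y \<le> B"
    unfolding mbounded_alt by blast
  have "mdiameter m \<le> B" if m: "m \<in> skeleton X" for m
  proof -
    obtain \<phi> where \<phi>: "mspace m \<noteq> {}" "isometric_map m X (mspace m) \<phi>"
      using m by (rule skeletonE)
    show ?thesis
      unfolding mdiameter_def
    proof (rule cSUP_least)
      show "mspace m \<times> mspace m \<noteq> {}" using \<phi>(1) by simp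
      fix z assume "z \<in> mspace m \<times> mspace m"
      then obtain x y where z: "z = (x, y)" and xy: "x \<in> mspace m" "y \<in> mspace m" by blast
      have "mdist X (\<phi> x) (\<phi> y) \<le> B"
        using isometric_mapD(1)[OF \<phi>(2)] xy B by blast
      then show "(case z of (x, y) \<Rightarrow> mdist m x y) \<le> B"
        using isometric_mapD(2)[OF \<phi>(2) xy] by (simp add: z)
    qed
  qed
  then show ?thesis by blast
qed

lemma mdist_le_mdiameter:
  assumes "finite (mspace m)" "x \<in> mspace m" "y \<in> mspace m"
  shows "mdist m x y \<le> mdiameter m"
proof -
  have "bdd_above ((\<lambda>(x, y). mdist m x y) ` (mspace m \<times> mspace m))"
    using assms(1) by (intro bdd_above_finite) simp
  from cSUP_upper[OF _ this, of "(x, y)"] show ?thesis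
    unfolding mdiameter_def using assms(2,3) by simp
qed

lemma Heine_Borel_bounded_imp_compact:
  assumes sk: "metric_skeletoid F" and age: "age_in F X" and hb: "Heine_Borel X"
    and B: "\<forall>m\<in>F. mdiameter m \<le> B"
  shows "compact_metric X"
proof (cases "mspace X = {}")
  case True
  then show ?thesis by (simp add: compact_metric_def compact_space_def)
next
  case False
  then obtain p where p: "p \<in> mspace X" by blast
  have "mdist X p x \<le> B" if x: "x \<in> mspace X" for x
  proof -
    have "embeddable F {p, x} (mdist X)" using p x by (intro age_inD[OF age]) auto
    then obtain m f where m: "m \<in> F" "f \<in> {p, x} \<rightarrow> mspace m"
      "\<forall>a\<in>{p, x}. \<forall>b\<in>{p, x}. mdist m (f a) (f b) = mdist X a b"
      unfolding embeddable_def by blast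
    then have "mdist X p x \<le> mdiameter m"
      using mdist_le_mdiameter[OF skeletoid_closed(1)[OF sk m(1)], of "f p" "f x"] by simp
    also have "\<dots> \<le> B" using B m(1) by blast
    finally show ?thesis .
  qed
  then have "mcball_of X p B = mspace X" using p by auto
  moreover have "compactin (mtopology_of X) (mcball_of X p B)"
    using hb p by (simp add: Heine_Borel_def)
  ultimately have "compactin (mtopology_of X) (mspace X)" by simp
  then show ?thesis by (simp add: compact_metric_def compact_space_def)
qed

section \<open>The characterization\<close>

text \<open>
  The saturated space found in the large universe has at most continuum many points, so it can be
  copied into any type that contains the reals.
\<close>
lemma saturated_exists_on:
  fixes e :: "real \<Rightarrow> 'a"
  assumes "inj e" "metric_skeletoid F" "size_bounded F" "F \<noteq> {}"
  shows "\<exists>X :: 'a metric. saturated F X"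
proof -
  obtain X :: "nat set set metric" where X: "saturated F X"
    using saturated_exists[OF assms(2-4)] by blast
  have "mspace X \<lesssim> (UNIV :: nat set set)"
    by (rule age_in_lepoll[OF assms(2,3) saturated_imp_age_in[OF X]])
  also have "(UNIV :: nat set set) \<approx> (UNIV :: real set)" by (rule nat_sets_eqpoll_reals)
  finally obtain \<phi> :: "nat set set \<Rightarrow> real" where "inj_on \<phi> (mspace X)"
    unfolding lepoll_def by blast
  then have "inj_on (e \<circ> \<phi>) (mspace X)"
    using assms(1) by (meson comp_inj_on inj_on_subset subset_UNIV)
  then show ?thesis by (rule saturated_transfer[OF X])
qed

lemma empty_space:
  fixes X :: "'b metric"
  assumes "mspace X = {}"
  shows "compact_metric X" "absolutely_homogeneous X" "skeleton X = {}"
proof -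
  show "compact_metric X" using assms by (simp add: compact_metric_def compact_space_def)
  show "absolutely_homogeneous X"
    using assms by (simp add: absolutely_homogeneous_def isometry_onto_def isometric_map_def)
  show "skeleton X = {}"
    using assms by (auto simp: skeleton_def isometric_def isometry_onto_def isometric_map_def)
qed

(* HOL cannot quantify over types, so the spaces X range over the metric spaces whose points
   are taken from a type 'a, which may be any type with at least continuum many elements.
   Heine-Borel spaces are separable and so have at most continuum many points: no space is lost. *)
theorem theorem3p34:
  fixes F :: "nat metric set" and e :: "real \<Rightarrow> 'a"
  assumes universe: "inj e"
    and skeletoid: "metric_skeletoid F"
  shows
    "((\<exists>X :: 'a metric. Heine_Borel X \<and> absolutely_homogeneous X \<and> F = skeleton X) \<longleftrightarrow>
        layer_closed F \<and> size_bounded F) \<and>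
     ((\<exists>X :: 'a metric. compact_metric X \<and> absolutely_homogeneous X \<and> F = skeleton X) \<longleftrightarrow>
        (layer_closed F \<and> size_bounded F) \<and> (\<exists>B. \<forall>m\<in>F. mdiameter m \<le> B))"
proof -
  have necessary: "layer_closed F \<and> size_bounded F"
    if "Heine_Borel X" "absolutely_homogeneous X" "F = skeleton X" for X :: "'a metric"
    using Heine_Borel_skeleton_layer_closed Heine_Borel_skeleton_size_bounded that by blast
  have sufficient: "\<exists>X :: 'a metric. Heine_Borel X \<and> absolutely_homogeneous X \<and> F = skeleton X \<and>
      ((\<exists>B. \<forall>m\<in>F. mdiameter m \<le> B) \<longrightarrow> compact_metric X)"
    if cond: "layer_closed F" "size_bounded F"
  proof (cases "F = {}")
    case True
    have "mspace (submetric undefined {} :: 'a metric) = {}" by simp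
    from empty_space[OF this] show ?thesis
      using True compact_metric_imp_Heine_Borel by metis
  next
    case False
    then obtain X :: "'a metric" where X: "saturated F X"
      using saturated_exists_on[OF universe skeletoid cond(2)] by blast
    have hb: "Heine_Borel X" by (rule saturated_Heine_Borel[OF skeletoid cond X])
    then show ?thesis
      using saturated_absolutely_homogeneous[OF skeletoid cond(1) X]
        saturated_skeleton[OF skeletoid cond(1) X]
        Heine_Borel_bounded_imp_compact[OF skeletoid saturated_imp_age_in[OF X] hb]
      by blast
  qed
  show ?thesis
    using necessary sufficient compact_metric_imp_Heine_Borel compact_metric_bounded_diameters
    by blast
qed

end
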